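(* Let $(A,\{\mu_k\}_{k\ge1},\{\mu'_k\}_{k\ge1})$ be a compatible $A_\infty$-algebra over a field of characteristic $0$. Then $(A,\{l_k\}_{k\ge1},\{l'_k\}_{k\ge1})$ is a compatible $L_\infty$-algebra, where $\{l_k\}_{k\ge1}$ and $\{l'_k\}_{k\ge1}$ are the skew-symmetrizations of $\{\mu_k\}_{k\ge1}$ and $\{\mu'_k\}_{k\ge1}$, respectively.
   Context: Signs and shuffles: for $\sigma\in S_n$ and homogeneous elements $x_1,\dots,x_n$, $\epsilon(\sigma)$ is the Koszul sign, defined by $x_{\sigma(1)}\odot\cdots\odot x_{\sigma(n)}=\epsilon(\sigma)\,x_1\odot\cdots\odot x_n$ in the graded symmetric algebra, and $\chi(\sigma)=(-1)^\sigma\epsilon(\sigma)$. $Sh(i,n-i)$ is the set of $\sigma\in S_n$ with $\sigma(1)<\cdots<\sigma(i)$ and $\sigma(i+1)<\cdots<\sigma(n)$. A graded multilinear map is skew-symmetric if permuting its arguments by $\sigma$ multiplies the value by $\chi(\sigma)$. An $A_\infty$-algebra $(A,\{\mu_k\}_{k\ge1})$ is a graded vector space $A=\oplus_{i\in\mathbb{Z}}A_i$ with graded multilinear maps $\mu_k:A^{\otimes k}\to A$ of degree $2-k$ such that for all $n\ge1$ and homogeneous $a_1,\dots,a_n\in A$, $$\sum_{i+j=n+1}\sum_{\lambda=1}^{j}(-1)^{\lambda(i+1)+ij+i(|a_1|+\cdots+|a_{\lambda-1}|)}\,\mu_j\big(a_1,\dots,a_{\lambda-1},\mu_i(a_\lambda,\dots,a_{\lambda+i-1}),a_{\lambda+i},\dots,a_n\big)=0.$$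 (Equivalently, with $W=s^{-1}A$ and $\tau_k=(-1)^{k(k-1)/2}s^{-1}\circ\mu_k\circ s^{\otimes k}$, the degree $1$ coderivation of the tensor coalgebra $TW$ induced by $\{\tau_k\}$ squares to zero.) A compatible $A_\infty$-algebra is a triple $(A,\{\mu_k\},\{\mu'_k\})$ such that $(A,\{\mu_k\})$, $(A,\{\mu'_k\})$ and $(A,\{\mu_k+\mu'_k\})$ are all $A_\infty$-algebras. The skew-symmetrization of $\{\mu_k\}_{k\ge1}$ is $l_k(a_1,\dots,a_k)=\sum_{\sigma\in S_k}(-1)^\sigma\epsilon(\sigma)\,\mu_k(a_{\sigma(1)},\dots,a_{\sigma(k)})$, $k\ge1$. An $L_\infty$-algebra is a graded vector space $L$ with skew-symmetric multilinear maps $l_k:L^{\otimes k}\to L$ of degree $2-k$, $k\ge1$, such that for all $n\ge1$, $$\sum_{i+j=n+1}\sum_{\sigma\in Sh(i,n-i)}\chi(\sigma)(-1)^{i(j-1)}\,l_j\big(l_i(x_{\sigma(1)},\dots,x_{\sigma(i)}),x_{\sigma(i+1)},\dots,x_{\sigma(n)}\big)=0.$$ A compatible $L_\infty$-algebra is a triple $(L,\{l_k\},\{l'_k\})$ where $(L,\{l_k\})$ and $(L,\{l'_k\})$ are $L_\infty$-algebras and $$\sum_{i+j=n+1}\sum_{\sigma\in Sh(i,n-i)}\chi(\sigma)(-1)^{i(j-1)}\Big\{l_j\big(l'_i(x_{\sigma(1)},\dots,x_{\sigma(i)}),x_{\sigma(i+1)},\dots,x_{\sigma(n)}\big)+l'_j\big(l_i(x_{\sigma(1)},\dots,x_{\sigma(i)}),x_{\sigma(i+1)},\dots,x_{\sigma(n)}\big)\Big\}=0$$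 for all $n\ge1$. *)

theory Defs
  imports Complex_Main "HOL-Combinatorics.Permutations"
begin

text \<open>The grading consists of subspaces of the whole type \<open>'a\<close>, which carries the vector space
  structure given by \<open>scale\<close>; the existence and uniqueness of the decomposition says that the
  vector space is their internal direct sum.\<close>

locale graded_vector_space = vector_space scale
  for scale :: "'k::field \<Rightarrow> 'a::ab_group_add \<Rightarrow> 'a" +
  fixes A :: "int \<Rightarrow> 'a set"
  assumes subspace_A: "subspace (A i)"
    and direct_sum: "\<exists>!f. finite {i. f i \<noteq> 0} \<and> (\<forall>i. f i \<in> A i) \<and> x = (\<Sum>i | f i \<noteq> 0. f i)"

definition hom_component :: "(int \<Rightarrow> 'a::ab_group_add set) \<Rightarrow> 'a \<Rightarrow> int \<Rightarrow> 'a" where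
  "hom_component A x =
    (THE f. finite {i. f i \<noteq> 0} \<and> (\<forall>i. f i \<in> A i) \<and> x = (\<Sum>i | f i \<noteq> 0. f i))"

text \<open>Since zero is homogeneous of every degree, signs depend on a list \<open>d\<close> of degrees
  chosen for the arguments \<open>xs\<close>; for nonzero homogeneous arguments \<open>d\<close> is determined by \<open>xs\<close>.\<close>

definition homogeneous :: "(int \<Rightarrow> 'a set) \<Rightarrow> int list \<Rightarrow> 'a list \<Rightarrow> bool" where
  "homogeneous A d xs \<longleftrightarrow> list_all2 (\<lambda>i x. x \<in> A i) d xs"

definition minus_one_pow :: "int \<Rightarrow> int" where
  "minus_one_pow e = (if even e then 1 else - 1)"

text \<open>Permutations act on the positions \<open>0, \<dots>, n - 1\<close>, so that
  \<open>permute_list \<sigma> xs\<close> is \<open>xs ! \<sigma> 0, \<dots>, xs ! \<sigma> (n - 1)\<close>. Each inversion of \<open>\<sigma>\<close> contributes the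
  sign of interchanging the two elements concerned. The lemma \<open>koszul_sign_graded_commutative\<close>
  below recovers the defining property of the Koszul sign.\<close>

definition koszul_sign :: "int list \<Rightarrow> (nat \<Rightarrow> nat) \<Rightarrow> int" where
  "koszul_sign d \<sigma> =
    (\<Prod>(p, q) | p < q \<and> q < length d \<and> \<sigma> q < \<sigma> p. minus_one_pow (d ! \<sigma> p * d ! \<sigma> q))"

definition chi :: "int list \<Rightarrow> (nat \<Rightarrow> nat) \<Rightarrow> int" where
  "chi d \<sigma> = sign \<sigma> * koszul_sign d \<sigma>"

definition shuffles_Sh :: "nat \<Rightarrow> nat \<Rightarrow> (nat \<Rightarrow> nat) set" where
  "shuffles_Sh i m =
    {\<sigma>. \<sigma> permutes {..<i + m} \<and> strict_mono_on {..<i} \<sigma> \<and> strict_mono_on {i..<i + m} \<sigma>}"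

text \<open>A \<open>k\<close>-ary map is a function on lists of which only the values on lists of length \<open>k\<close> matter.\<close>

definition multilinear_map ::
  "('k::field \<Rightarrow> 'a::ab_group_add \<Rightarrow> 'a) \<Rightarrow> nat \<Rightarrow> ('a list \<Rightarrow> 'a) \<Rightarrow> bool" where
  "multilinear_map scale k f \<longleftrightarrow>
    (\<forall>xs p. length xs = k \<longrightarrow> p < k \<longrightarrow>
      (\<forall>x y. f (xs[p := x + y]) = f (xs[p := x]) + f (xs[p := y])) \<and>
      (\<forall>c x. f (xs[p := scale c x]) = scale c (f (xs[p := x]))))"

definition has_degree ::
  "(int \<Rightarrow> 'a set) \<Rightarrow> nat \<Rightarrow> int \<Rightarrow> ('a list \<Rightarrow> 'a) \<Rightarrow> bool" where
  "has_degree A k e f \<longleftrightarrow>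
    (\<forall>d xs. length xs = k \<longrightarrow> homogeneous A d xs \<longrightarrow> f xs \<in> A (sum_list d + e))"

definition skew_symmetric ::
  "('k::field \<Rightarrow> 'a::ab_group_add \<Rightarrow> 'a) \<Rightarrow> (int \<Rightarrow> 'a set) \<Rightarrow> nat \<Rightarrow> ('a list \<Rightarrow> 'a) \<Rightarrow> bool" where
  "skew_symmetric scale A k f \<longleftrightarrow>
    (\<forall>d xs \<sigma>. length xs = k \<longrightarrow> homogeneous A d xs \<longrightarrow> \<sigma> permutes {..<k} \<longrightarrow>
      f (permute_list \<sigma> xs) = scale (of_int (chi d \<sigma>)) (f xs))"

definition A_infinity_algebra ::
  "('k::field \<Rightarrow> 'a::ab_group_add \<Rightarrow> 'a) \<Rightarrow> (int \<Rightarrow> 'a set) \<Rightarrow> (nat \<Rightarrow> 'a list \<Rightarrow> 'a) \<Rightarrow> bool" where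
  "A_infinity_algebra scale A \<mu> \<longleftrightarrow>
    graded_vector_space scale A \<and>
    (\<forall>k\<ge>1. multilinear_map scale k (\<mu> k) \<and> has_degree A k (2 - int k) (\<mu> k)) \<and>
    (\<forall>n\<ge>1. \<forall>d as. length as = n \<longrightarrow> homogeneous A d as \<longrightarrow>
      (\<Sum>(i, j) | 1 \<le> i \<and> 1 \<le> j \<and> i + j = n + 1. \<Sum>l = 1..j.
        scale (of_int (minus_one_pow
            (int (l * (i + 1) + i * j) + int i * sum_list (take (l - 1) d))))
          (\<mu> j (take (l - 1) as @ [\<mu> i (take i (drop (l - 1) as))] @ drop (l - 1 + i) as))) = 0)"

definition compatible_A_infinity_algebra ::
  "('k::field \<Rightarrow> 'a::ab_group_add \<Rightarrow> 'a) \<Rightarrow> (int \<Rightarrow> 'a set) \<Rightarrow>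
    (nat \<Rightarrow> 'a list \<Rightarrow> 'a) \<Rightarrow> (nat \<Rightarrow> 'a list \<Rightarrow> 'a) \<Rightarrow> bool" where
  "compatible_A_infinity_algebra scale A \<mu> \<mu>' \<longleftrightarrow>
    A_infinity_algebra scale A \<mu> \<and> A_infinity_algebra scale A \<mu>' \<and>
    A_infinity_algebra scale A (\<lambda>k as. \<mu> k as + \<mu>' k as)"

text \<open>\<open>L_infinity_sum scale l l' n d xs\<close> is the left-hand side of the \<open>n\<close>-th \<open>L\<^sub>\<infinity>\<close> identity, with
  the outer operation taken from \<open>l\<close> and the inner one from \<open>l'\<close>.\<close>

definition L_infinity_sum ::
  "('k::field \<Rightarrow> 'a::ab_group_add \<Rightarrow> 'a) \<Rightarrow> (nat \<Rightarrow> 'a list \<Rightarrow> 'a) \<Rightarrow> (nat \<Rightarrow> 'a list \<Rightarrow> 'a) \<Rightarrow>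
    nat \<Rightarrow> int list \<Rightarrow> 'a list \<Rightarrow> 'a" where
  "L_infinity_sum scale l l' n d xs =
    (\<Sum>(i, j) | 1 \<le> i \<and> 1 \<le> j \<and> i + j = n + 1. \<Sum>\<sigma>\<in>shuffles_Sh i (n - i).
      scale (of_int (chi d \<sigma> * minus_one_pow (int i * (int j - 1))))
        (l j (l' i (take i (permute_list \<sigma> xs)) # drop i (permute_list \<sigma> xs))))"

definition L_infinity_algebra ::
  "('k::field \<Rightarrow> 'a::ab_group_add \<Rightarrow> 'a) \<Rightarrow> (int \<Rightarrow> 'a set) \<Rightarrow> (nat \<Rightarrow> 'a list \<Rightarrow> 'a) \<Rightarrow> bool" where
  "L_infinity_algebra scale L l \<longleftrightarrow>
    graded_vector_space scale L \<and>
    (\<forall>k\<ge>1. multilinear_map scale k (l k) \<and> has_degree L k (2 - int k) (l k) \<and>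
      skew_symmetric scale L k (l k)) \<and>
    (\<forall>n\<ge>1. \<forall>d xs. length xs = n \<longrightarrow> homogeneous L d xs \<longrightarrow> L_infinity_sum scale l l n d xs = 0)"

definition compatible_L_infinity_algebra ::
  "('k::field \<Rightarrow> 'a::ab_group_add \<Rightarrow> 'a) \<Rightarrow> (int \<Rightarrow> 'a set) \<Rightarrow>
    (nat \<Rightarrow> 'a list \<Rightarrow> 'a) \<Rightarrow> (nat \<Rightarrow> 'a list \<Rightarrow> 'a) \<Rightarrow> bool" where
  "compatible_L_infinity_algebra scale L l l' \<longleftrightarrow>
    L_infinity_algebra scale L l \<and> L_infinity_algebra scale L l' \<and>
    (\<forall>n\<ge>1. \<forall>d xs. length xs = n \<longrightarrow> homogeneous L d xs \<longrightarrow>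
      L_infinity_sum scale l l' n d xs + L_infinity_sum scale l' l n d xs = 0)"

text \<open>The formula for the skew-symmetrization makes sense on homogeneous arguments. It is extended
  multilinearly by applying it to the homogeneous components of the arguments; the list \<open>d\<close> ranges
  over all choices of a nonzero component of each argument. See \<open>skew_symmetrization_homogeneous\<close>
  below.\<close>

definition skew_symmetrization ::
  "('k::field \<Rightarrow> 'a::ab_group_add \<Rightarrow> 'a) \<Rightarrow> (int \<Rightarrow> 'a set) \<Rightarrow> (nat \<Rightarrow> 'a list \<Rightarrow> 'a) \<Rightarrow>
    nat \<Rightarrow> 'a list \<Rightarrow> 'a" where
  "skew_symmetrization scale A \<mu> k xs =
    (\<Sum>d | list_all2 (\<lambda>x i. hom_component A x i \<noteq> 0) xs d. \<Sum>\<sigma> | \<sigma> permutes {..<k}.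
      scale (of_int (sign \<sigma> * koszul_sign d \<sigma>))
        (\<mu> k (permute_list \<sigma> (map2 (hom_component A) xs d))))"

subsection \<open>Checks of the definitions\<close>

lemma (in graded_vector_space) hom_component_homogeneous:
  assumes "x \<in> A i"
  shows "hom_component A x = (\<lambda>j. if j = i then x else 0)"
proof -
  let ?P = "\<lambda>f. finite {i. f i \<noteq> 0} \<and> (\<forall>i. f i \<in> A i) \<and> x = (\<Sum>i | f i \<noteq> 0. f i)"
  let ?g = "\<lambda>j. if j = i then x else 0"
  have sub: "{j. ?g j \<noteq> 0} \<subseteq> {i}" by auto
  have "(\<Sum>j | ?g j \<noteq> 0. ?g j) = (\<Sum>j\<in>{i}. ?g j)"
    by (rule sum.mono_neutral_left) auto
  then have "?P ?g"
    using assms subspace_A subspace_0 finite_subset[OF sub] by simp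
  with direct_sum[of x] show ?thesis
    unfolding hom_component_def by (intro the1_equality) auto
qed

lemma multilinear_map_zero:
  assumes "vector_space scale" "multilinear_map scale (length xs) f" "0 \<in> set xs"
  shows "f xs = 0"
proof -
  interpret vector_space scale by fact
  from assms(3) obtain p where p: "p < length xs" "xs ! p = 0" by (metis in_set_conv_nth)
  then have "f (xs[p := scale 0 0]) = scale 0 (f (xs[p := 0]))"
    using assms(2) unfolding multilinear_map_def by blast
  then show ?thesis using p by (metis list_update_id scale_zero_left)
qed

lemma skew_symmetrization_homogeneous:
  assumes "graded_vector_space scale A" "multilinear_map scale k (\<mu> k)"
    and "length xs = k" "homogeneous A d xs"
  shows "skew_symmetrization scale A \<mu> k xs =
    (\<Sum>\<sigma> | \<sigma> permutes {..<k}.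
      scale (of_int (sign \<sigma> * koszul_sign d \<sigma>)) (\<mu> k (permute_list \<sigma> xs)))"
proof -
  interpret graded_vector_space scale A by fact
  have len: "length d = length xs" and mem: "\<And>p. p < length xs \<Longrightarrow> xs ! p \<in> A (d ! p)"
    using assms(4) by (auto simp: homogeneous_def list_all2_conv_all_nth)
  have comp: "hom_component A (xs ! p) j = (if j = d ! p then xs ! p else 0)"
    if "p < length xs" for p j
    using hom_component_homogeneous[OF mem[OF that]] by simp
  show ?thesis
  proof (cases "0 \<in> set xs")
    case True
    then obtain p where p: "p < length xs" "xs ! p = 0" by (metis in_set_conv_nth)
    have *: "{d. list_all2 (\<lambda>x i. hom_component A x i \<noteq> 0) xs d} = {}"
      using comp[OF p(1)] p by (auto simp: list_all2_conv_all_nth)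
    have "\<mu> k (permute_list \<sigma> xs) = 0" if "\<sigma> permutes {..<k}" for \<sigma>
      using that True assms(2,3)
      by (intro multilinear_map_zero[OF vector_space_axioms])
        (auto simp: set_permute_list)
    then show ?thesis unfolding skew_symmetrization_def * by simp
  next
    case False
    have eq: "{e. list_all2 (\<lambda>x i. hom_component A x i \<noteq> 0) xs e} = {d}"
    proof safe
      fix e assume "list_all2 (\<lambda>x i. hom_component A x i \<noteq> 0) xs e"
      then have "length e = length xs" "\<And>p. p < length xs \<Longrightarrow> e ! p = d ! p"
        using comp by (auto simp: list_all2_conv_all_nth split: if_splits)
      then show "e = d" using len by (auto intro: nth_equalityI)
    next
      show "list_all2 (\<lambda>x i. hom_component A x i \<noteq> 0) xs d"
        using comp len False nth_mem by (fastforce simp: list_all2_conv_all_nth)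
    qed
    have "map2 (hom_component A) xs d = xs"
      using comp len by (auto intro: nth_equalityI)
    with eq show ?thesis unfolding skew_symmetrization_def by simp
  qed
qed

text \<open>The assumption \<open>comm\<close> is the defining commutation rule of the graded symmetric algebra, and the
  conclusion is the defining property of the Koszul sign there.\<close>

lemma koszul_sign_graded_commutative:
  fixes xs :: "'r::ring_1 list"
  assumes "length d = length xs" "\<sigma> permutes {..<length xs}"
    and comm: "\<And>p q. p < length xs \<Longrightarrow> q < length xs \<Longrightarrow>
      xs ! p * xs ! q = of_int (minus_one_pow (d ! p * d ! q)) * (xs ! q * xs ! p)"
  shows "prod_list (permute_list \<sigma> xs) = of_int (koszul_sign d \<sigma>) * prod_list xs"
proof -
  define s where "s p q = minus_one_pow (d ! p * d ! q)" for p q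
  define K where "K w = (\<Prod>(p, q) | p < q \<and> q < length w \<and> w ! q < w ! p. s (w ! p) (w ! q))"
    for w :: "nat list"
  let ?x = "\<lambda>p. xs ! p"
  have lcomm: "x * (of_int m * y) = of_int m * (x * y)" for x y :: 'r and m :: int
  proof -
    have "x * (of_int m * y) = (x * of_int m) * y" by (simp only: mult.assoc)
    also have "x * of_int m = of_int m * x" by (simp only: mult_of_int_commute)
    finally show ?thesis by (simp only: mult.assoc)
  qed
  have cons: "K (a # w) = (\<Prod>b | b \<in> set w \<and> b < a. s a b) * K w"
    if "distinct w" for a w
  proof -
    let ?S = "{(p, q). p < q \<and> q < length (a # w) \<and> (a # w) ! q < (a # w) ! p}"
    let ?T = "{(p, q). p < q \<and> q < length w \<and> w ! q < w ! p}"
    let ?U = "{q. q < length w \<and> w ! q < a}"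
    let ?f = "\<lambda>(p, q). s ((a # w) ! p) ((a # w) ! q)"
    have S: "?S = (\<lambda>q. (0, Suc q)) ` ?U \<union> map_prod Suc Suc ` ?T" (is "_ = ?R")
    proof (intro set_eqI)
      fix z :: "nat \<times> nat"
      obtain p q where z: "z = (p, q)" by (cases z)
      show "z \<in> ?S \<longleftrightarrow> z \<in> ?R"
        unfolding z by (cases p; cases q) (auto simp: image_iff)
    qed
    have finT: "finite ?T"
      by (rule finite_subset[of _ "{..<length w} \<times> {..<length w}"]) auto
    have "K (a # w) = prod ?f ?S" by (simp add: K_def)
    also have "\<dots> = prod ?f ((\<lambda>q. (0, Suc q)) ` ?U) * prod ?f (map_prod Suc Suc ` ?T)"
      unfolding S using finT by (intro prod.union_disjoint) auto
    also have "prod ?f ((\<lambda>q. (0, Suc q)) ` ?U) = (\<Prod>q\<in>?U. s a (w ! q))"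
      by (subst prod.reindex) (auto simp: inj_on_def)
    also have "\<dots> = prod (s a) ((!) w ` ?U)"
      using that by (subst prod.reindex) (auto simp: inj_on_def nth_eq_iff_index_eq)
    also have "(!) w ` ?U = {b. b \<in> set w \<and> b < a}"
      by (auto simp: in_set_conv_nth image_iff)
    also have "prod ?f (map_prod Suc Suc ` ?T) = K w"
      unfolding K_def
      by (subst prod.reindex) (auto simp: inj_on_def case_prod_beta intro!: prod.cong)
    finally show ?thesis .
  qed
  have ins: "?x a * prod_list (map ?x v) =
      of_int (\<Prod>b | b \<in> set v \<and> b < a. s a b) * prod_list (map ?x (insort a v))"
    if "sorted v" "distinct v" "a \<notin> set v" "a < length xs" "set v \<subseteq> {..<length xs}" for a v
    using that
  proof (induction v)
    case Nil
    then show ?case by simp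
  next
    case (Cons c v)
    show ?case
    proof (cases "a \<le> c")
      case True
      then have *: "{b. b \<in> set (c # v) \<and> b < a} = {}" using Cons.prems by auto
      show ?thesis unfolding * using True by simp
    next
      case False
      then have set_eq: "{b. b \<in> set (c # v) \<and> b < a} = insert c {b. b \<in> set v \<and> b < a}" by auto
      have "?x a * prod_list (map ?x (c # v)) = (?x a * ?x c) * prod_list (map ?x v)"
        by (simp add: mult.assoc)
      also have "?x a * ?x c = of_int (s a c) * (?x c * ?x a)"
        unfolding s_def using Cons.prems by (intro comm) auto
      also have "of_int (s a c) * (?x c * ?x a) * prod_list (map ?x v) =
          of_int (s a c) * (?x c * (?x a * prod_list (map ?x v)))"
        by (simp add: mult.assoc)
      also have "?x a * prod_list (map ?x v) =
          of_int (\<Prod>b | b \<in> set v \<and> b < a. s a b) * prod_list (map ?x (insort a v))"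
        using Cons.prems by (intro Cons.IH) auto
      also have "of_int (s a c) * (?x c * \<dots>) =
          of_int (s a c * (\<Prod>b | b \<in> set v \<and> b < a. s a b)) * (?x c * prod_list (map ?x (insort a v)))"
        by (subst lcomm[of "?x c"]) (simp only: of_int_mult mult.assoc)
      finally show ?thesis
        using False Cons.prems unfolding set_eq by (subst prod.insert) auto
    qed
  qed
  have sort: "prod_list (map ?x w) = of_int (K w) * prod_list (map ?x (sort w))"
    if "distinct w" "set w \<subseteq> {..<length xs}" for w
    using that
  proof (induction w)
    case Nil
    have "K [] = 1" by (simp add: K_def)
    then show ?case by simp
  next
    case (Cons a w)
    have "prod_list (map ?x (a # w)) = ?x a * (of_int (K w) * prod_list (map ?x (sort w)))"
      using Cons by simp
    also have "\<dots> = of_int (K w) * (?x a * prod_list (map ?x (sort w)))"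
      by (rule lcomm)
    also have "?x a * prod_list (map ?x (sort w)) =
        of_int (\<Prod>b | b \<in> set w \<and> b < a. s a b) * prod_list (map ?x (insort a (sort w)))"
      using Cons.prems ins[of "sort w" a] by simp
    also have "of_int (K w) * \<dots> =
        of_int ((\<Prod>b | b \<in> set w \<and> b < a. s a b) * K w) * prod_list (map ?x (insort a (sort w)))"
      by (simp only: mult.assoc[symmetric] of_int_mult[symmetric] mult.commute[of "K w"])
    also have "\<dots> = of_int (K (a # w)) * prod_list (map ?x (sort (a # w)))"
      using Cons.prems by (simp add: cons)
    finally show ?case .
  qed
  let ?w = "map \<sigma> [0..<length xs]"
  have inj: "inj_on \<sigma> {0..<length xs}"
    using assms(2) permutes_inj_on by blast
  have set_w: "set ?w = {0..<length xs}"
    using permutes_image[OF assms(2)] by (simp add: atLeast0LessThan)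
  have "sort ?w = [0..<length xs]"
    using set_w inj by (intro sorted_distinct_set_unique) (auto simp: distinct_map)
  moreover have "K ?w = koszul_sign d \<sigma>"
    unfolding K_def koszul_sign_def s_def using assms(1) by (intro prod.cong) auto
  moreover have "prod_list (map ?x ?w) = of_int (K ?w) * prod_list (map ?x (sort ?w))"
    using set_w inj by (intro sort) (auto simp: distinct_map)
  moreover have "map ?x ?w = permute_list \<sigma> xs" by (simp add: permute_list_def)
  moreover have "map ?x [0..<length xs] = xs" by (rule map_nth)
  ultimately show ?thesis by simp
qed

end

theory Submission
  imports Defs "HOL-Combinatorics.Multiset_Permutations"
begin

text \<open>Write \<open>J\<close> for the left-hand side of the \<open>A\<^sub>\<infinity>\<close> identity, as an expression bilinear in the
  outer and the inner family of operations. For skew-symmetrizations \<open>l\<close>, \<open>l'\<close> of \<open>\<mu>\<close>, \<open>\<mu>'\<close>, the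
  \<open>n\<close>-th \<open>L\<^sub>\<infinity>\<close> expression with outer operation \<open>l\<close> and inner operation \<open>l'\<close> equals
  \<open>- (\<Sum>\<pi> \<in> S\<^sub>n. \<chi>(\<pi>) J\<^bsub>\<mu>,\<mu>'\<^esub>(x\<^bsub>\<pi>(1)\<^esub>, \<dots>, x\<^bsub>\<pi>(n)\<^esub>))\<close>: a shuffle, a permutation of the inner block and a permutation
  of the outer arguments together amount to a permutation \<open>\<pi>\<close> and a position for the block, and
  the signs agree because \<open>\<chi>\<close> is a product over inversions. The diagonal cases vanish by the
  \<open>A\<^sub>\<infinity>\<close> identities of \<open>\<mu>\<close> and \<open>\<mu>'\<close>; that of \<open>\<mu> + \<mu>'\<close> then kills the sum of the mixed terms.\<close>

subsection \<open>Signs of words\<close>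

text \<open>The weight \<open>s\<close> is arbitrary: the constant -1 gives the signature, the
  parity of degree products the Koszul sign. Words over any linear order are allowed, so that blocks
  of arguments can keep their original labels.\<close>

definition inversion_prod :: "('b::linorder \<Rightarrow> 'b \<Rightarrow> int) \<Rightarrow> 'b list \<Rightarrow> int" where
  "inversion_prod s w = (\<Prod>(p, q) | p < q \<and> q < length w \<and> w ! q < w ! p. s (w ! p) (w ! q))"

text \<open>The inversions between two blocks, the letters of \<open>U\<close> standing before those
  of \<open>V\<close>; the order inside a block does not matter for them.\<close>

definition cross_prod :: "('b::linorder \<Rightarrow> 'b \<Rightarrow> int) \<Rightarrow> 'b set \<Rightarrow> 'b set \<Rightarrow> int" where
  "cross_prod s U V = (\<Prod>a\<in>U. \<Prod>b\<in>V. if b < a then s a b else 1)"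

lemma inversion_prod_Nil [simp]: "inversion_prod s [] = 1"
  by (simp add: inversion_prod_def)

text \<open>Inversions either start at position 0 or are shifted inversions of the tail.
  Distinctness turns the product over positions into one over letters.\<close>

lemma inversion_prod_Cons:
  assumes "distinct w"
  shows "inversion_prod s (a # w) = cross_prod s {a} (set w) * inversion_prod s w"
proof -
  let ?S = "{(p, q). p < q \<and> q < length (a # w) \<and> (a # w) ! q < (a # w) ! p}"
  let ?T = "{(p, q). p < q \<and> q < length w \<and> w ! q < w ! p}"
  let ?U = "{q. q < length w \<and> w ! q < a}"
  let ?f = "\<lambda>(p, q). s ((a # w) ! p) ((a # w) ! q)"
  have S: "?S = (\<lambda>q. (0, Suc q)) ` ?U \<union> map_prod Suc Suc ` ?T" (is "_ = ?R")
  proof (intro set_eqI)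
    fix z :: "nat \<times> nat"
    obtain p q where z: "z = (p, q)" by (cases z)
    show "z \<in> ?S \<longleftrightarrow> z \<in> ?R"
      unfolding z by (cases p; cases q) (auto simp: image_iff)
  qed
  have fin: "finite ?T"
    by (rule finite_subset[of _ "{..<length w} \<times> {..<length w}"]) auto
  have "inversion_prod s (a # w) = prod ?f ((\<lambda>q. (0, Suc q)) ` ?U \<union> map_prod Suc Suc ` ?T)"
    unfolding inversion_prod_def S ..
  also have "\<dots> = prod ?f ((\<lambda>q. (0, Suc q)) ` ?U) * prod ?f (map_prod Suc Suc ` ?T)"
    using fin by (intro prod.union_disjoint) auto
  also have "prod ?f ((\<lambda>q. (0, Suc q)) ` ?U) = (\<Prod>q\<in>?U. s a (w ! q))"
    by (subst prod.reindex) (auto simp: inj_on_def)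
  also have "\<dots> = prod (s a) ((!) w ` ?U)"
    using assms by (subst prod.reindex) (auto simp: inj_on_def nth_eq_iff_index_eq)
  also have "(!) w ` ?U = {b \<in> set w. b < a}"
    by (auto simp: in_set_conv_nth image_iff)
  also have "prod (s a) {b \<in> set w. b < a} = cross_prod s {a} (set w)"
    by (simp add: cross_prod_def prod.inter_filter)
  also have "prod ?f (map_prod Suc Suc ` ?T) = inversion_prod s w"
    unfolding inversion_prod_def
    by (subst prod.reindex) (auto simp: inj_on_def case_prod_beta intro!: prod.cong)
  finally show ?thesis .
qed

lemma cross_prod_Un_left:
  assumes "finite U" "finite V" "U \<inter> V = {}"
  shows "cross_prod s (U \<union> V) W = cross_prod s U W * cross_prod s V W"
  using assms by (simp add: cross_prod_def prod.union_disjoint)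

lemma cross_prod_Un_right:
  assumes "finite V" "finite W" "V \<inter> W = {}"
  shows "cross_prod s U (V \<union> W) = cross_prod s U V * cross_prod s U W"
  using assms by (simp add: cross_prod_def prod.union_disjoint prod.distrib)

text \<open>Peeling letters off \<open>u\<close> sorts the inversions into those inside
  \<open>u\<close>, those inside \<open>v\<close> and those running from \<open>u\<close> to
  \<open>v\<close>.\<close>

lemma inversion_prod_append:
  assumes "distinct (u @ v)"
  shows "inversion_prod s (u @ v) =
    inversion_prod s u * inversion_prod s v * cross_prod s (set u) (set v)"
  using assms
proof (induction u)
  case Nil
  then show ?case by (simp add: cross_prod_def)
next
  case (Cons a u)
  then have "cross_prod s (insert a (set u)) (set v) = cross_prod s {a} (set v) * cross_prod s (set u) (set v)"
    using cross_prod_Un_left[of "{a}" "set u" s "set v"] by simp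
  moreover have "cross_prod s {a} (set u \<union> set v) = cross_prod s {a} (set u) * cross_prod s {a} (set v)"
    using Cons.prems by (intro cross_prod_Un_right) auto
  ultimately show ?case
    using Cons by (simp add: inversion_prod_Cons)
qed

lemma inversion_prod_sorted:
  assumes "sorted w" "distinct w"
  shows "inversion_prod s w = 1"
  using assms
proof (induction w)
  case (Cons a w)
  then have "cross_prod s {a} (set w) = 1"
    by (fastforce simp: cross_prod_def intro!: prod.neutral)
  with Cons show ?case by (simp add: inversion_prod_Cons)
qed simp

lemma inversion_prod_map_strict_mono:
  assumes "strict_mono_on (set w) f" "distinct w"
  shows "inversion_prod s (map f w) = inversion_prod (\<lambda>a b. s (f a) (f b)) w"
proof -
  have "(f (w ! q) < f (w ! p)) = (w ! q < w ! p)" if "p < q" "q < length w" for p q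
    using strict_mono_on_less[OF assms(1), of "w ! q" "w ! p"] that by simp
  then show ?thesis
    unfolding inversion_prod_def by (intro prod.cong) auto
qed

lemma inversion_prod_cong:
  assumes "\<And>a b. a \<in> set w \<Longrightarrow> b \<in> set w \<Longrightarrow> s a b = t a b"
  shows "inversion_prod s w = inversion_prod t w"
  unfolding inversion_prod_def using assms by (intro prod.cong) auto

lemma inversion_prod_mult:
  "inversion_prod (\<lambda>a b. s a b * t a b) w = inversion_prod s w * inversion_prod t w"
  unfolding inversion_prod_def by (simp add: prod.distrib case_prod_beta)

lemma inversion_prod_square:
  assumes "\<And>a b. s a b * s a b = 1"
  shows "inversion_prod s w * inversion_prod s w = 1"
  unfolding inversion_prod_def using assms
  by (simp flip: prod.distrib add: case_prod_beta)

lemma cross_prod_square: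
  assumes "\<And>a b. s a b * s a b = 1"
  shows "cross_prod s U V * cross_prod s U V = 1"
  unfolding cross_prod_def using assms
  by (simp flip: prod.distrib) (auto intro!: prod.neutral)

text \<open>Each pair of letters from disjoint sets is inverted in exactly one of the two orders of
  the blocks, and symmetry of \<open>s\<close> makes its weight the same in both.\<close>

lemma cross_prod_swap:
  assumes "\<And>a b. s a b = s b a" "finite U" "finite V" "U \<inter> V = {}"
  shows "cross_prod s U V * cross_prod s V U = (\<Prod>a\<in>U. \<Prod>b\<in>V. s a b)"
proof -
  have "cross_prod s V U = (\<Prod>a\<in>U. \<Prod>b\<in>V. if a < b then s b a else 1)"
    unfolding cross_prod_def by (rule prod.swap)
  then have "cross_prod s U V * cross_prod s V U =
      (\<Prod>a\<in>U. \<Prod>b\<in>V. (if b < a then s a b else 1) * (if a < b then s b a else 1))"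
    by (simp add: cross_prod_def prod.distrib)
  also have "\<dots> = (\<Prod>a\<in>U. \<Prod>b\<in>V. s a b)"
    using assms(1,4) by (intro prod.cong) (auto simp: not_less_iff_gr_or_eq)
  finally show ?thesis .
qed

section \<open>Inversion products of permutations and of their composites\<close>

lemma inversion_prod_map_upt:
  "inversion_prod s (map \<sigma> [0..<n]) =
    (\<Prod>(p, q) | p < q \<and> q < n \<and> \<sigma> q < \<sigma> p. s (\<sigma> p) (\<sigma> q))"
  unfolding inversion_prod_def by (intro prod.cong) auto

text \<open>The inversion condition moves from the index set into the factor, so that products for
  different permutations range over the same pairs.\<close>

lemma inversion_prod_permutation:
  "inversion_prod s (map \<sigma> [0..<n]) =
    (\<Prod>(p, q) | p < q \<and> q < n. if \<sigma> q < \<sigma> p then s (\<sigma> p) (\<sigma> q) else 1)"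
proof -
  have fin: "finite {(p, q). p < q \<and> q < (n::nat)}"
    by (rule finite_subset[of _ "{..<n} \<times> {..<n}"]) auto
  have "inversion_prod s (map \<sigma> [0..<n]) =
      (\<Prod>z\<in>{z \<in> {(p, q). p < q \<and> q < n}. \<sigma> (snd z) < \<sigma> (fst z)}. s (\<sigma> (fst z)) (\<sigma> (snd z)))"
    unfolding inversion_prod_map_upt by (intro prod.cong) auto
  also have "\<dots> = (\<Prod>z\<in>{(p, q). p < q \<and> q < n}.
      if \<sigma> (snd z) < \<sigma> (fst z) then s (\<sigma> (fst z)) (\<sigma> (snd z)) else 1)"
    using fin by (rule prod.inter_filter)
  finally show ?thesis by (simp add: case_prod_beta)
qed

text \<open>A permutation acts on the two-element sets of positions. Symmetry of \<open>h\<close>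
  makes this a product over such sets, each represented by its increasing pair.\<close>

lemma prod_pairs_permute:
  fixes h :: "nat \<Rightarrow> nat \<Rightarrow> int"
  assumes "\<And>p q. p \<noteq> q \<Longrightarrow> h p q = h q p" "\<tau> permutes {..<n}"
  shows "(\<Prod>(p, q) | p < q \<and> q < n. h (\<tau> p) (\<tau> q)) = (\<Prod>(p, q) | p < q \<and> q < n. h p q)"
proof -
  define P where "P = {(p, q). p < q \<and> q < n}"
  \<comment> \<open>\<open>r\<close> applies a permutation to a pair and puts the result back in
    increasing order.\<close>
  define r where "r \<rho> = (\<lambda>(p, q). (min (\<rho> p) (\<rho> q), max (\<rho> p) (\<rho> q)))" for \<rho> :: "nat \<Rightarrow> nat"
  have r: "r \<rho> z \<in> P" "r (inv \<rho>) (r \<rho> z) = z" if \<rho>: "\<rho> permutes {..<n}" and z: "z \<in> P" for \<rho> z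
  proof -
    obtain p q where pq: "z = (p, q)" "p < q" "q < n"
      using z by (cases z) (simp add: P_def)
    have "\<rho> p < n" "\<rho> q < n" using permutes_in_image[OF \<rho>] pq by auto
    moreover have "\<rho> p \<noteq> \<rho> q" using permutes_inj[OF \<rho>] pq by (auto simp: inj_def)
    ultimately show "r \<rho> z \<in> P" "r (inv \<rho>) (r \<rho> z) = z"
      using pq permutes_inverses[OF \<rho>] by (auto simp: P_def r_def min_def max_def)
  qed
  have i: "inv \<tau> permutes {..<n}" "inv (inv \<tau>) = \<tau>"
    using assms(2) by (auto intro: permutes_inv permutes_inv_inv)
  have "(\<Prod>z\<in>P. h (\<tau> (fst z)) (\<tau> (snd z))) = (\<Prod>z\<in>P. h (fst z) (snd z))"
  proof (rule prod.reindex_bij_witness[where i = "r (inv \<tau>)" and j = "r \<tau>"])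
    fix z assume z: "z \<in> P"
    then have "\<tau> (fst z) \<noteq> \<tau> (snd z)"
      using permutes_inj[OF assms(2)] by (cases z) (simp add: P_def inj_eq)
    then show "h (fst (r \<tau> z)) (snd (r \<tau> z)) = h (\<tau> (fst z)) (\<tau> (snd z))"
      using assms(1) by (cases z) (auto simp: r_def min_def max_def)
  qed (use r[OF assms(2)] r[OF i(1)] i(2) in auto)
  then show ?thesis by (simp add: P_def case_prod_beta)
qed

text \<open>The composite inverts a pair exactly when one, but not both, of the two stages reverses
  its order. If both do, its weight occurs twice on the right and squares to 1.\<close>

lemma inversion_prod_compose:
  assumes s: "\<And>a b. s a b = s b a" "\<And>a b. s a b * s a b = 1"
    and "\<sigma> permutes {..<n}" "\<tau> permutes {..<n}"
  shows "inversion_prod s (map (\<sigma> \<circ> \<tau>) [0..<n]) =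
    inversion_prod s (map \<sigma> [0..<n]) * inversion_prod (\<lambda>a b. s (\<sigma> a) (\<sigma> b)) (map \<tau> [0..<n])"
proof -
  \<comment> \<open>\<open>h\<close> is the weight of a pair whose order \<open>\<sigma>\<close>
    reverses, written symmetrically in \<open>p\<close> and \<open>q\<close> so that the product can
    be reindexed along \<open>\<tau>\<close>.\<close>
  define h where "h p q = (if (p < q) \<noteq> (\<sigma> p < \<sigma> q) then s (\<sigma> p) (\<sigma> q) else 1)" for p q
  have neq: "\<sigma> p \<noteq> \<sigma> q" "\<tau> p \<noteq> \<tau> q" if "p \<noteq> q" for p q
    using permutes_inj[OF assms(3)] permutes_inj[OF assms(4)] that by (simp_all add: inj_eq)
  have sym: "h p q = h q p" if "p \<noteq> q" for p q
    using neq(1)[OF that] that s(1) by (auto simp: h_def)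
  have "inversion_prod s (map \<sigma> [0..<n]) = (\<Prod>(p, q) | p < q \<and> q < n. h p q)"
    unfolding inversion_prod_permutation using neq(1)
    by (intro prod.cong) (auto simp: h_def not_less_iff_gr_or_eq)
  also have "\<dots> = (\<Prod>(p, q) | p < q \<and> q < n. h (\<tau> p) (\<tau> q))"
    by (rule prod_pairs_permute[where h = h, OF sym assms(4), symmetric])
  finally have \<sigma>: "inversion_prod s (map \<sigma> [0..<n]) = \<dots>" .
  have step: "(if \<sigma> (\<tau> q) < \<sigma> (\<tau> p) then s (\<sigma> (\<tau> p)) (\<sigma> (\<tau> q)) else 1) =
      h (\<tau> p) (\<tau> q) * (if \<tau> q < \<tau> p then s (\<sigma> (\<tau> p)) (\<sigma> (\<tau> q)) else 1)"
    if "p < q" for p q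
  proof -
    have "\<tau> p \<noteq> \<tau> q" "\<sigma> (\<tau> p) \<noteq> \<sigma> (\<tau> q)" using neq that by auto
    then consider "\<tau> p < \<tau> q" "\<sigma> (\<tau> p) < \<sigma> (\<tau> q)" | "\<tau> p < \<tau> q" "\<sigma> (\<tau> q) < \<sigma> (\<tau> p)"
      | "\<tau> q < \<tau> p" "\<sigma> (\<tau> p) < \<sigma> (\<tau> q)" | "\<tau> q < \<tau> p" "\<sigma> (\<tau> q) < \<sigma> (\<tau> p)"
      by linarith
    then show ?thesis by cases (simp_all add: h_def s(2))
  qed
  show ?thesis
    unfolding \<sigma> inversion_prod_permutation[of s "\<sigma> \<circ> \<tau>"] inversion_prod_permutation[of _ \<tau>]
      prod.distrib[symmetric]
    by (intro prod.cong refl) (clarify, simp only: prod.case o_apply step)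
qed

text \<open>With weight -1 the inversion product is multiplicative. Transpositions generate the
  symmetric group and are conjugate to the one exchanging 0 and 1, which has a single
  inversion.\<close>

lemma sign_eq_inversion_prod:
  assumes "\<sigma> permutes {..<n}"
  shows "sign \<sigma> = inversion_prod (\<lambda>_ _. - 1) (map \<sigma> [0..<n])"
proof -
  define I where "I \<rho> = inversion_prod (\<lambda>_ _. - 1) (map \<rho> [0..<n])" for \<rho> :: "nat \<Rightarrow> nat"
  have comp: "I (\<rho> \<circ> \<tau>) = I \<rho> * I \<tau>" if "\<rho> permutes {..<n}" "\<tau> permutes {..<n}" for \<rho> \<tau>
    unfolding I_def using that by (intro inversion_prod_compose) auto
  have id: "I id = 1"
    unfolding I_def by (rule inversion_prod_sorted) auto
  have swap01: "I (transpose 0 1) = - 1" if "1 < n"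
  proof -
    have "{(p, q). p < q \<and> q < n \<and> transpose 0 1 q < transpose 0 1 p} = {(0, 1)}"
      using that by (auto simp: transpose_def split: if_splits)
    then show ?thesis by (simp add: I_def inversion_prod_map_upt)
  qed
  have sq: "I \<rho> * I \<rho> = 1" for \<rho>
    unfolding I_def by (rule inversion_prod_square) simp
  have swap1: "I (transpose a b) = - 1" if "a < n" "b < n" "a \<noteq> b" for a b
  proof -
    \<comment> \<open>A permutation taking \<open>a\<close> to 0 and \<open>b\<close> to 1: first
      exchange \<open>a\<close> with 0, then move the resulting image of \<open>b\<close> to
      1.\<close>
    define \<rho> where "\<rho> = transpose (transpose 0 a b) 1 \<circ> transpose 0 a"
    have n: "1 < n" "transpose 0 a b < n" using that by (auto simp: transpose_def)
    have \<rho>: "\<rho> permutes {..<n}"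
      unfolding \<rho>_def using that n by (intro permutes_compose permutes_swap_id) auto
    have ab: "\<rho> a = 0" "\<rho> b = 1" using that by (auto simp: \<rho>_def transpose_def)
    have inj: "\<rho> x = \<rho> y \<longleftrightarrow> x = y" for x y
      using permutes_inj[OF \<rho>] by (simp add: inj_eq)
    have "transpose 0 1 \<circ> \<rho> = \<rho> \<circ> transpose a b"
    proof
      fix x
      show "(transpose 0 1 \<circ> \<rho>) x = (\<rho> \<circ> transpose a b) x"
      proof (cases "x = a \<or> x = b")
        case True
        then show ?thesis using ab by auto
      next
        case False
        then have "\<rho> x \<noteq> 0" "\<rho> x \<noteq> 1" using inj[of x a] inj[of x b] ab by auto
        with False show ?thesis by simp
      qed
    qed
    moreover have "transpose 0 1 permutes {..<n}" "transpose a b permutes {..<n}"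
      using n that by (auto intro: permutes_swap_id)
    \<comment> \<open>Conjugation by \<open>\<rho>\<close> cannot change the value, since
      \<open>I\<close> is multiplicative into the integers and \<open>I \<rho>\<close> is
      nonzero.\<close>
    ultimately have "I (transpose 0 1) * I \<rho> = I \<rho> * I (transpose a b)"
      using comp[OF _ \<rho>] comp[OF \<rho>] by metis
    moreover have "I \<rho> \<noteq> 0" using sq[of \<rho>] by auto
    ultimately show ?thesis using swap01[OF n(1)] by simp
  qed
  show ?thesis
    using assms finite_lessThan[of n] unfolding I_def[symmetric]
  proof (induction rule: permutes_induct)
    case id
    then show ?case using \<open>I id = 1\<close> by (simp only: sign_id)
  next
    case (swap a b p)
    have "I (transpose a b \<circ> p) = - I p"
      using comp[of "transpose a b" p] swap1[of a b] swap by (simp add: permutes_swap_id)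
    moreover have "sign (transpose a b \<circ> p) = - sign p"
      using permutes_imp_permutation[of "{..<n}" p] swap
      by (simp add: sign_compose sign_swap_id permutation_swap_id)
    ultimately show ?case using swap by metis
  qed
qed

section \<open>The sign \<open>chi\<close> as an inversion product\<close>

lemma minus_one_pow_add: "minus_one_pow (a + b) = minus_one_pow a * minus_one_pow b"
  by (simp add: minus_one_pow_def)

lemma minus_one_pow_square [simp]: "minus_one_pow a * minus_one_pow a = 1"
  by (simp add: minus_one_pow_def)

text \<open>The minus sign is the share of the signature in one inversion, so that a single weight
  produces all of \<open>chi\<close>.\<close>

definition skew_sign :: "('b \<Rightarrow> int) \<Rightarrow> 'b \<Rightarrow> 'b \<Rightarrow> int" where
  "skew_sign D a b = - minus_one_pow (D a * D b)"

lemma skew_sign_commute: "skew_sign D a b = skew_sign D b a"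
  by (simp add: skew_sign_def mult.commute)

lemma skew_sign_square [simp]: "skew_sign D a b * skew_sign D a b = 1"
  by (simp add: skew_sign_def)

lemma chi_eq_inversion_prod:
  assumes "\<sigma> permutes {..<length d}"
  shows "chi d \<sigma> = inversion_prod (skew_sign ((!) d)) (map \<sigma> [0..<length d])"
proof -
  have "koszul_sign d \<sigma> =
      inversion_prod (\<lambda>a b. minus_one_pow (d ! a * d ! b)) (map \<sigma> [0..<length d])"
    by (simp add: koszul_sign_def inversion_prod_map_upt)
  moreover have "skew_sign ((!) d) = (\<lambda>a b. (\<lambda>_ _. - 1) a b * minus_one_pow (d ! a * d ! b))"
    by (intro ext) (simp add: skew_sign_def)
  ultimately show ?thesis
    using assms by (simp only: chi_def sign_eq_inversion_prod inversion_prod_mult)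
qed

text \<open>An instance of the composition rule. Once \<open>\<sigma>\<close> has moved the
  arguments, the weight sees the degrees in their new positions, so \<open>chi\<close> is a crossed
  homomorphism.\<close>

lemma chi_compose:
  assumes "\<sigma> permutes {..<length d}" "\<tau> permutes {..<length d}"
  shows "chi d (\<sigma> \<circ> \<tau>) = chi d \<sigma> * chi (permute_list \<sigma> d) \<tau>"
proof -
  let ?s = "skew_sign ((!) d)"
  have "chi (permute_list \<sigma> d) \<tau> =
      inversion_prod (skew_sign ((!) (permute_list \<sigma> d))) (map \<tau> [0..<length d])"
    using assms by (simp add: chi_eq_inversion_prod)
  also have "\<dots> = inversion_prod (\<lambda>a b. ?s (\<sigma> a) (\<sigma> b)) (map \<tau> [0..<length d])"
  proof (rule inversion_prod_cong)
    fix a b assume "a \<in> set (map \<tau> [0..<length d])" "b \<in> set (map \<tau> [0..<length d])"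
    moreover have "set (map \<tau> [0..<length d]) = {..<length d}"
      by (simp add: atLeast0LessThan permutes_image[OF assms(2)])
    ultimately have "a < length d" "b < length d" by blast+
    then show "skew_sign ((!) (permute_list \<sigma> d)) a b = ?s (\<sigma> a) (\<sigma> b)"
      using assms(1) by (simp add: skew_sign_def permute_list_nth)
  qed
  finally have "chi (permute_list \<sigma> d) \<tau> = \<dots>" .
  moreover have "chi d (\<sigma> \<circ> \<tau>) = inversion_prod ?s (map (\<sigma> \<circ> \<tau>) [0..<length d])"
    using assms by (intro chi_eq_inversion_prod permutes_compose)
  moreover have "chi d \<sigma> = inversion_prod ?s (map \<sigma> [0..<length d])"
    using assms(1) by (rule chi_eq_inversion_prod)
  moreover have "inversion_prod ?s (map (\<sigma> \<circ> \<tau>) [0..<length d]) =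
      inversion_prod ?s (map \<sigma> [0..<length d]) *
      inversion_prod (\<lambda>a b. ?s (\<sigma> a) (\<sigma> b)) (map \<tau> [0..<length d])"
    by (rule inversion_prod_compose[where s = ?s, OF skew_sign_commute skew_sign_square assms])
  ultimately show ?thesis by (simp only:)
qed

lemma chi_square:
  assumes "\<sigma> permutes {..<length d}"
  shows "chi d \<sigma> * chi d \<sigma> = 1"
  using assms by (simp add: chi_eq_inversion_prod inversion_prod_square)

text \<open>A strictly increasing list of labels does not change the inversions of a permutation, so that
  \<open>chi\<close> becomes a function of the permuted word of labels.\<close>

lemma chi_word:
  assumes "sorted L" "distinct L" "\<sigma> permutes {..<length L}"
  shows "chi (map D L) \<sigma> = inversion_prod (skew_sign D) (permute_list \<sigma> L)"
proof -
  let ?w = "map \<sigma> [0..<length L]"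
  have w: "distinct ?w" "set ?w = {..<length L}"
    using permutes_inj_on[OF assms(3)] permutes_image[OF assms(3)]
    by (auto simp: distinct_map atLeast0LessThan)
  have "strict_mono_on (set ?w) ((!) L)"
    using assms(1,2) w(2) by (auto simp: strict_mono_on_def sorted_wrt_nth_less strict_sorted_iff)
  then have "inversion_prod (skew_sign D) (permute_list \<sigma> L) =
      inversion_prod (\<lambda>a b. skew_sign D (L ! a) (L ! b)) ?w"
    unfolding permute_list_def using w(1)
    by (subst inversion_prod_map_strict_mono[symmetric]) (auto simp: comp_def)
  also have "\<dots> = chi (map D L) \<sigma>"
    using assms w(2) by (subst chi_eq_inversion_prod)
      (auto simp: skew_sign_def intro!: inversion_prod_cong)
  finally show ?thesis ..
qed

subsection \<open>Sums over words\<close>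

lemma bij_betw_permute_list:
  assumes "distinct L"
  shows "bij_betw (\<lambda>\<sigma>. permute_list \<sigma> L) {\<sigma>. \<sigma> permutes {..<length L}} (permutations_of_set (set L))"
proof (rule bij_betw_imageI)
  show "inj_on (\<lambda>\<sigma>. permute_list \<sigma> L) {\<sigma>. \<sigma> permutes {..<length L}}"
  proof (rule inj_onI, clarsimp)
    fix \<sigma> \<tau> assume *: "\<sigma> permutes {..<length L}" "\<tau> permutes {..<length L}"
      "permute_list \<sigma> L = permute_list \<tau> L"
    show "\<sigma> = \<tau>"
    proof
      fix k
      show "\<sigma> k = \<tau> k"
      proof (cases "k < length L")
        case True
        then have "L ! \<sigma> k = L ! \<tau> k" "\<sigma> k < length L" "\<tau> k < length L"
          using permute_list_nth[OF *(1) True] permute_list_nth[OF *(2) True] *(3)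
            permutes_in_image[OF *(1), of k] permutes_in_image[OF *(2), of k] by simp_all
        then show ?thesis using assms by (simp add: nth_eq_iff_index_eq)
      next
        case False
        then show ?thesis using permutes_not_in[OF *(1), of k] permutes_not_in[OF *(2), of k] by simp
      qed
    qed
  qed
  show "(\<lambda>\<sigma>. permute_list \<sigma> L) ` {\<sigma>. \<sigma> permutes {..<length L}} = permutations_of_set (set L)"
  proof (intro equalityI subsetI)
    fix w assume "w \<in> permutations_of_set (set L)"
    then have "mset w = mset L"
      using assms by (auto simp: permutations_of_set_def simp flip: set_eq_iff_mset_eq_distinct)
    then obtain \<sigma> where "\<sigma> permutes {..<length L}" "permute_list \<sigma> L = w"
      by (rule mset_eq_permutation)
    then show "w \<in> (\<lambda>\<sigma>. permute_list \<sigma> L) ` {\<sigma>. \<sigma> permutes {..<length L}}" by blast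
  qed (use assms in \<open>auto intro!: permutations_of_setI\<close>)
qed

text \<open>Turns sums over permutations into sums over words whose sign is read off the word
  itself, independently of the positions of the letters in \<open>L\<close>.\<close>

lemma sum_permutes_chi:
  assumes "sorted L" "distinct L"
  shows "(\<Sum>\<sigma> | \<sigma> permutes {..<length L}. F (chi (map D L) \<sigma>) (permute_list \<sigma> L)) =
    (\<Sum>w\<in>permutations_of_set (set L). F (inversion_prod (skew_sign D) w) w)"
proof -
  have "(\<Sum>\<sigma> | \<sigma> permutes {..<length L}. F (chi (map D L) \<sigma>) (permute_list \<sigma> L)) =
      (\<Sum>\<sigma> | \<sigma> permutes {..<length L}.
        F (inversion_prod (skew_sign D) (permute_list \<sigma> L)) (permute_list \<sigma> L))"
    using assms by (intro sum.cong) (auto simp: chi_word)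
  also have "\<dots> = (\<Sum>w\<in>permutations_of_set (set L). F (inversion_prod (skew_sign D) w) w)"
    by (rule sum.reindex_bij_betw[OF bij_betw_permute_list[OF assms(2)]])
  finally show ?thesis .
qed

section \<open>Shuffles as subsets\<close>

lemma sorted_list_of_set_image:
  assumes "strict_mono_on (set L) f" "sorted L" "distinct L"
  shows "sorted_list_of_set (f ` set L) = map f L"
proof -
  have "sorted (map f L)" "distinct (map f L)"
    using assms strict_mono_on_imp_inj_on[OF assms(1)]
    by (auto simp: sorted_iff_nth_mono distinct_map strict_mono_on_leD)
  then show ?thesis
    using sorted_list_of_set.idem_if_sorted_distinct[of "map f L"] by simp
qed

text \<open>A shuffle is determined by the set \<open>S\<close> of its first \<open>i\<close>
  values, because both blocks must be listed in increasing order.\<close>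

lemma shuffles_Sh_words:
  fixes i m :: nat
  defines "N \<equiv> {..<i + m}"
  shows "(\<lambda>\<sigma>. permute_list \<sigma> [0..<i + m]) ` shuffles_Sh i m =
    (\<lambda>S. sorted_list_of_set S @ sorted_list_of_set (N - S)) ` {S. S \<subseteq> N \<and> card S = i}"
proof (intro equalityI subsetI)
  fix w assume "w \<in> (\<lambda>\<sigma>. permute_list \<sigma> [0..<i + m]) ` shuffles_Sh i m"
  then obtain \<sigma> where \<sigma>: "\<sigma> permutes N" "strict_mono_on {..<i} \<sigma>" "strict_mono_on {i..<i + m} \<sigma>"
    and w: "w = permute_list \<sigma> [0..<i + m]"
    by (auto simp: shuffles_Sh_def N_def)
  have inj: "inj \<sigma>" using \<sigma>(1) by (rule permutes_inj)
  have "N - {..<i} = {i..<i + m}" by (auto simp: N_def)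
  then have compl: "N - \<sigma> ` {..<i} = \<sigma> ` {i..<i + m}"
    using image_set_diff[OF inj, of N "{..<i}"] permutes_image[OF \<sigma>(1)] by simp
  have upt: "[0..<i + m] = [0..<i] @ [i..<i + m]"
    using upt_add_eq_append[of 0 i m] by simp
  have "\<sigma> x < i + m" if "x < i + m" for x
    using permutes_in_image[OF \<sigma>(1), of x] that by (simp add: N_def)
  then have "w = map \<sigma> [0..<i + m]"
    unfolding w permute_list_def by (intro map_cong) auto
  then have "w = map \<sigma> [0..<i] @ map \<sigma> [i..<i + m]"
    unfolding upt by simp
  moreover have "sorted_list_of_set (\<sigma> ` {..<i}) = map \<sigma> [0..<i]"
    using sorted_list_of_set_image[of "[0..<i]" \<sigma>] \<sigma>(2) by (simp add: lessThan_atLeast0)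
  moreover have "sorted_list_of_set (\<sigma> ` {i..<i + m}) = map \<sigma> [i..<i + m]"
    using sorted_list_of_set_image[of "[i..<i + m]" \<sigma>] \<sigma>(3) by simp
  moreover have "\<sigma> ` {..<i} \<subseteq> N" "card (\<sigma> ` {..<i}) = i"
    using permutes_image[OF \<sigma>(1)] inj by (auto simp: N_def card_image inj_on_subset)
  ultimately show "w \<in> (\<lambda>S. sorted_list_of_set S @ sorted_list_of_set (N - S)) ` {S. S \<subseteq> N \<and> card S = i}"
    by (intro image_eqI[of _ _ "\<sigma> ` {..<i}"]) (auto simp: compl)
next
  fix w assume "w \<in> (\<lambda>S. sorted_list_of_set S @ sorted_list_of_set (N - S)) ` {S. S \<subseteq> N \<and> card S = i}"
  then obtain S where S: "S \<subseteq> N" "card S = i"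
    and w: "w = sorted_list_of_set S @ sorted_list_of_set (N - S)" by auto
  have fin: "finite S" "finite (N - S)" using S(1) finite_subset by (auto simp: N_def)
  have "w \<in> permutations_of_set (set [0..<i + m])"
    using S fin unfolding w by (intro permutations_of_setI) (auto simp: N_def)
  then obtain \<sigma> where \<sigma>: "\<sigma> permutes {..<i + m}" "w = permute_list \<sigma> [0..<i + m]"
    using bij_betw_permute_list[of "[0..<i + m]"] by (auto simp: bij_betw_def)
  have len: "length (sorted_list_of_set S) = i" "length (sorted_list_of_set (N - S)) = m"
    using S fin by (auto simp: card_Diff_subset N_def)
  have nth: "\<sigma> k = w ! k" if "k < i + m" for k
    using permute_list_nth[of \<sigma> "[0..<i + m]" k] permutes_in_image[OF \<sigma>(1), of k] \<sigma> that by simp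
  have "strict_mono_on {..<i} \<sigma>"
    using len sorted_wrt_nth_less[OF strict_sorted_list_of_set[of S]]
    by (auto simp: strict_mono_on_def nth w nth_append)
  moreover have "strict_mono_on {i..<i + m} \<sigma>"
    using len sorted_wrt_nth_less[OF strict_sorted_list_of_set[of "N - S"]]
    by (auto simp: strict_mono_on_def nth w nth_append)
  ultimately show "w \<in> (\<lambda>\<sigma>. permute_list \<sigma> [0..<i + m]) ` shuffles_Sh i m"
    using \<sigma> by (auto simp: shuffles_Sh_def)
qed

lemma sum_shuffles_Sh:
  fixes i m :: nat
  defines "N \<equiv> {..<i + m}"
  shows "(\<Sum>\<sigma>\<in>shuffles_Sh i m. F (permute_list \<sigma> [0..<i + m])) =
    (\<Sum>S | S \<subseteq> N \<and> card S = i. F (sorted_list_of_set S @ sorted_list_of_set (N - S)))"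
proof -
  let ?W = "\<lambda>S. sorted_list_of_set S @ sorted_list_of_set (N - S)"
  have "inj_on (\<lambda>\<sigma>. permute_list \<sigma> [0..<i + m]) (shuffles_Sh i m)"
    using bij_betw_permute_list[of "[0..<i + m]"]
    by (auto simp: bij_betw_def shuffles_Sh_def intro: inj_on_subset)
  \<comment> \<open>\<open>S\<close> is recovered from its word as the set of the first
    \<open>i\<close> letters.\<close>
  moreover have "inj_on ?W {S. S \<subseteq> N \<and> card S = i}"
  proof (rule inj_on_inverseI)
    fix S assume "S \<in> {S. S \<subseteq> N \<and> card S = i}"
    moreover from this have "finite S" using finite_subset by (auto simp: N_def)
    ultimately show "set (take i (?W S)) = S" by simp
  qed
  ultimately show ?thesis
    using sum.reindex[of "\<lambda>\<sigma>. permute_list \<sigma> [0..<i + m]" "shuffles_Sh i m" F]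
      sum.reindex[of ?W "{S. S \<subseteq> N \<and> card S = i}" F] shuffles_Sh_words[of i m, folded N_def]
    by (simp add: comp_def)
qed

text \<open>For a fixed cut position \<open>p\<close>, a word amounts to the set \<open>S\<close> of
  the \<open>i\<close> letters that follow the first \<open>p\<close>, their order \<open>u\<close>,
  and the order \<open>v\<close> of the others. The bound on \<open>p\<close> gives
  \<open>take p v\<close> exactly \<open>p\<close> letters, so the block can be cut out
  again.\<close>

lemma sum_permutations_of_set_block:
  assumes "finite N" "card N = i + m" "p \<le> m"
  shows "(\<Sum>w\<in>permutations_of_set N. G w) =
    (\<Sum>S | S \<subseteq> N \<and> card S = i. \<Sum>u\<in>permutations_of_set S. \<Sum>v\<in>permutations_of_set (N - S).
      G (take p v @ u @ drop p v))"
proof -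
  let ?Z = "SIGMA S:{S. S \<subseteq> N \<and> card S = i}. permutations_of_set S \<times> permutations_of_set (N - S)"
  have "(\<Sum>S | S \<subseteq> N \<and> card S = i. \<Sum>u\<in>permutations_of_set S. \<Sum>v\<in>permutations_of_set (N - S).
      G (take p v @ u @ drop p v)) = (\<Sum>(S, u, v)\<in>?Z. G (take p v @ u @ drop p v))"
    using assms(1) by (simp add: sum.Sigma sum.cartesian_product)
  also have "\<dots> = (\<Sum>w\<in>permutations_of_set N. G w)"
  proof (rule sum.reindex_bij_witness[where
        i = "\<lambda>w. (set (take i (drop p w)), take i (drop p w), take p w @ drop (p + i) w)"
        and j = "\<lambda>(S, u, v). take p v @ u @ drop p v"])
    fix z assume "z \<in> ?Z"
    then obtain S u v where z: "z = (S, u, v)" "S \<subseteq> N" "card S = i" "set u = S" "distinct u"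
      "set v = N - S" "distinct v"
      by (auto simp: permutations_of_set_def)
    then have len: "length u = i" "length v = m"
      using assms distinct_card[of u] distinct_card[of v]
      by (auto simp: card_Diff_subset finite_subset)
    have v: "set (take p v) \<union> set (drop p v) = N - S" "set (take p v) \<inter> set (drop p v) = {}"
      using z set_append[of "take p v" "drop p v"] distinct_append[of "take p v" "drop p v"] by auto
    show "(case z of (S, u, v) \<Rightarrow> take p v @ u @ drop p v) \<in> permutations_of_set N"
      using z v by (auto intro!: permutations_of_setI)
    show "(case case z of (S, u, v) \<Rightarrow> take p v @ u @ drop p v of
        w \<Rightarrow> (set (take i (drop p w)), take i (drop p w), take p w @ drop (p + i) w)) = z"
      using z len assms(3) by simp
  next
    fix w assume "w \<in> permutations_of_set N"
    then have w: "set w = N" "distinct w" "length w = i + m"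
      using assms(2) by (auto dest: permutations_of_setD length_finite_permutations_of_set)
    let ?a = "take p w" and ?u = "take i (drop p w)" and ?b = "drop (p + i) w"
    have split: "w = ?a @ ?u @ ?b"
      by (metis append_take_drop_id drop_drop add.commute)
    have "distinct (?a @ ?u @ ?b)" "set (?a @ ?u @ ?b) = N" using w split by metis+
    moreover have "length ?u = i" using w assms(3) by simp
    ultimately show "(set ?u, ?u, ?a @ ?b) \<in> ?Z"
      using distinct_card[of ?u]
      by (intro SigmaI CollectI conjI permutations_of_setI) auto
    show "(case (set ?u, ?u, ?a @ ?b) of (S, u, v) \<Rightarrow> take p v @ u @ drop p v) = w"
      using w assms(3) split by simp
  qed auto
  finally show ?thesis ..
qed

text \<open>The place of \<open>a\<close> and the word left after deleting it determine the original
  word; there are \<open>card T + 1\<close> places.\<close>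

lemma sum_permutations_of_set_insert:
  assumes "finite T" "a \<notin> T"
  shows "(\<Sum>w\<in>permutations_of_set (insert a T). G w) =
    (\<Sum>v\<in>permutations_of_set T. \<Sum>p\<le>card T. G (take p v @ a # drop p v))"
proof -
  have "(\<Sum>v\<in>permutations_of_set T. \<Sum>p\<le>card T. G (take p v @ a # drop p v)) =
      (\<Sum>(v, p)\<in>permutations_of_set T \<times> {..card T}. G (take p v @ a # drop p v))"
    by (rule sum.cartesian_product)
  also have "\<dots> = (\<Sum>w\<in>permutations_of_set (insert a T). G w)"
  proof (rule sum.reindex_bij_witness[where
        i = "\<lambda>w. (remove1 a w, length (takeWhile (\<lambda>x. x \<noteq> a) w))"
        and j = "\<lambda>(v, p). take p v @ a # drop p v"])
    fix z assume "z \<in> permutations_of_set T \<times> {..card T}"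
    then obtain v p where z: "z = (v, p)" "set v = T" "distinct v" "p \<le> length v"
      using distinct_card by (fastforce simp: permutations_of_set_def)
    have v: "set (take p v) \<union> set (drop p v) = T" "set (take p v) \<inter> set (drop p v) = {}"
      using z set_append[of "take p v" "drop p v"] distinct_append[of "take p v" "drop p v"] by auto
    show "(case z of (v, p) \<Rightarrow> take p v @ a # drop p v) \<in> permutations_of_set (insert a T)"
      using z v assms(2) by (auto intro!: permutations_of_setI)
    have "a \<notin> set (take p v)" using v assms(2) by auto
    then have "takeWhile (\<lambda>x. x \<noteq> a) (take p v @ a # drop p v) = take p v"
      by (subst takeWhile_append2) auto
    with \<open>a \<notin> set (take p v)\<close> show "(remove1 a (case z of (v, p) \<Rightarrow> take p v @ a # drop p v),
        length (takeWhile (\<lambda>x. x \<noteq> a) (case z of (v, p) \<Rightarrow> take p v @ a # drop p v))) = z"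
      using z by (simp add: remove1_append)
  next
    fix w assume "w \<in> permutations_of_set (insert a T)"
    then have w: "set w = insert a T" "distinct w" "length w = Suc (card T)"
      using assms by (auto dest: permutations_of_setD length_finite_permutations_of_set)
    then obtain x y where xy: "w = x @ a # y" "a \<notin> set x" by (metis insertI1 split_list_first)
    have "takeWhile (\<lambda>x. x \<noteq> a) (x @ a # y) = x"
      using xy(2) by (subst takeWhile_append2) auto
    then have tw: "takeWhile (\<lambda>x. x \<noteq> a) w = x" "remove1 a w = x @ y"
      using xy by (auto simp: remove1_append)
    show "(remove1 a w, length (takeWhile (\<lambda>x. x \<noteq> a) w)) \<in> permutations_of_set T \<times> {..card T}"
      unfolding tw using w xy assms(2) by (auto intro!: permutations_of_setI)
    show "(case (remove1 a w, length (takeWhile (\<lambda>x. x \<noteq> a) w)) of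
        (v, p) \<Rightarrow> take p v @ a # drop p v) = w"
      unfolding tw using xy by simp
  qed auto
  finally show ?thesis ..
qed

subsection \<open>Signs of inserted blocks\<close>

lemma minus_one_pow_cong:
  assumes "even (a - b)"
  shows "minus_one_pow a = minus_one_pow b"
  using assms by (simp add: minus_one_pow_def)

lemma minus_one_pow_sum: "minus_one_pow (\<Sum>a\<in>U. f a) = (\<Prod>a\<in>U. minus_one_pow (f a))"
proof (induction U rule: infinite_finite_induct)
  case (insert a U)
  then show ?case by (simp add: minus_one_pow_add)
qed (simp_all add: minus_one_pow_def)

text \<open>Each factor has exponent \<open>1 + D a * D b\<close>. Summing over all pairs gives the
  product of the cardinalities and, by distributivity, the product of the total degrees.\<close>

lemma prod_skew_sign:
  "(\<Prod>a\<in>U. \<Prod>b\<in>V. skew_sign D a b) =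
    minus_one_pow (int (card U) * int (card V) + sum D U * sum D V)"
proof -
  have "skew_sign D a b = minus_one_pow (1 + D a * D b)" for a b
    by (simp add: skew_sign_def minus_one_pow_def)
  then show ?thesis
    by (simp add: minus_one_pow_sum[symmetric] sum.distrib sum_product)
qed

text \<open>Compared with \<open>u @ v\<close>, only the pairs between \<open>u\<close> and the
  prefix \<open>take p v\<close> change their order. The last factor is the skew sign of moving the
  block \<open>u\<close> past that prefix.\<close>

lemma inversion_prod_block:
  assumes "distinct (u @ v)"
  shows "inversion_prod (skew_sign D) (take p v @ u @ drop p v) =
    inversion_prod (skew_sign D) u * inversion_prod (skew_sign D) v *
    cross_prod (skew_sign D) (set u) (set v) *
    minus_one_pow (int (length u) * int (length (take p v)) +
      sum_list (map D u) * sum_list (map D (take p v)))"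
proof -
  let ?I = "inversion_prod (skew_sign D)" and ?C = "cross_prod (skew_sign D)"
  let ?v = "take p v" and ?w = "drop p v"
  have v: "v = ?v @ ?w" by simp
  have dis: "distinct (u @ ?v @ ?w)" using assms by simp
  then have disj: "set u \<inter> set ?v = {}" "set u \<inter> set ?w = {}" "set ?v \<inter> set ?w = {}"
    "distinct u" "distinct ?v" "distinct ?w"
    unfolding distinct_append set_append by blast+
  have "?I (?v @ u @ ?w) = ?I ?v * (?I u * ?I ?w * ?C (set u) (set ?w)) *
      (?C (set ?v) (set u) * ?C (set ?v) (set ?w))"
    using disj by (simp add: inversion_prod_append cross_prod_Un_right Int_commute Int_Un_distrib)
  moreover have "?I v = ?I ?v * ?I ?w * ?C (set ?v) (set ?w)"
    using inversion_prod_append[of ?v ?w] assms by simp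
  moreover have "?C (set u) (set v) = ?C (set u) (set ?v) * ?C (set u) (set ?w)"
    using cross_prod_Un_right[of "set ?v" "set ?w"] disj by (metis List.finite_set set_append v)
  \<comment> \<open>The two orders together contribute every pair once; since cross products of
    signs square to 1, one factor can be moved to the other side.\<close>
  moreover have "?C (set ?v) (set u) = ?C (set u) (set ?v) * (\<Prod>a\<in>set u. \<Prod>b\<in>set ?v. skew_sign D a b)"
  proof -
    have "?C (set u) (set ?v) * ?C (set ?v) (set u) = (\<Prod>a\<in>set u. \<Prod>b\<in>set ?v. skew_sign D a b)"
      using disj by (intro cross_prod_swap skew_sign_commute) auto
    moreover have "?C (set u) (set ?v) * ?C (set u) (set ?v) = 1"
      by (rule cross_prod_square) (rule skew_sign_square)
    ultimately show ?thesis by (metis mult.assoc mult_1)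
  qed
  moreover have "(\<Prod>a\<in>set u. \<Prod>b\<in>set ?v. skew_sign D a b) =
      minus_one_pow (int (length u) * int (length ?v) + sum_list (map D u) * sum_list (map D ?v))"
    using disj by (simp add: prod_skew_sign distinct_card sum_list_distinct_conv_sum_set)
  ultimately show ?thesis by (simp only: ac_simps)
qed

text \<open>The arguments of the outer operation are labelled by \<open>0\<close> for the value of the inner operation,
  of degree \<open>e\<close>, and by \<open>Suc a\<close> for the remaining argument with label \<open>a\<close>.\<close>

lemma sum_permutations_of_set_insert_zero:
  fixes T :: "nat set"
  assumes "finite T" "card T = m"
  shows "(\<Sum>w\<in>permutations_of_set (insert 0 (Suc ` T)). G (inversion_prod (skew_sign (case_nat e D)) w) w) =
    (\<Sum>v\<in>permutations_of_set T. \<Sum>p\<le>m.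
      G (inversion_prod (skew_sign D) v * minus_one_pow (int p + e * sum_list (map D (take p v))))
        (map Suc (take p v) @ 0 # map Suc (drop p v)))"
proof -
  let ?D = "case_nat e D"
  let ?I = "inversion_prod (skew_sign ?D)"
  have "(\<Sum>w\<in>permutations_of_set (insert 0 (Suc ` T)). G (?I w) w) =
      (\<Sum>v\<in>permutations_of_set (Suc ` T). \<Sum>p\<le>card (Suc ` T). G (?I (take p v @ 0 # drop p v)) (take p v @ 0 # drop p v))"
    using assms by (intro sum_permutations_of_set_insert) auto
  also have "\<dots> = (\<Sum>v\<in>permutations_of_set T. \<Sum>p\<le>m.
      G (?I (map Suc (take p v) @ 0 # map Suc (drop p v))) (map Suc (take p v) @ 0 # map Suc (drop p v)))"
    using assms by (simp add: permutations_of_set_image_inj card_image sum.reindex inj_on_def take_map drop_map)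
  also have "\<dots> = (\<Sum>v\<in>permutations_of_set T. \<Sum>p\<le>m.
      G (inversion_prod (skew_sign D) v * minus_one_pow (int p + e * sum_list (map D (take p v))))
        (map Suc (take p v) @ 0 # map Suc (drop p v)))"
  proof (intro sum.cong refl)
    fix v p assume "v \<in> permutations_of_set T" "p \<in> {..m}"
    then have v: "distinct v" "length (take p v) = p"
      using assms by (auto simp: permutations_of_set_def distinct_card)
    have "?I (map Suc v) = inversion_prod (\<lambda>a b. skew_sign ?D (Suc a) (Suc b)) v"
      using v by (intro inversion_prod_map_strict_mono) (auto simp: strict_mono_on_def)
    also have "(\<lambda>a b. skew_sign ?D (Suc a) (Suc b)) = skew_sign D"
      by (intro ext) (simp add: skew_sign_def)
    finally have "?I (map Suc v) = inversion_prod (skew_sign D) v" .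
    \<comment> \<open>Label 0 is below every successor, so it causes no inversion at the front of
      the word. Moving it to place \<open>p\<close> then costs only the sign of a one-letter
      block.\<close>
    moreover have "cross_prod (skew_sign ?D) {0} (set (map Suc v)) = 1"
      by (simp add: cross_prod_def)
    moreover have "?I [0] = 1"
      by (rule inversion_prod_sorted) auto
    moreover have "map ?D (map Suc (take p v)) = map D (take p v)" by simp
    ultimately have "?I (map Suc (take p v) @ 0 # map Suc (drop p v)) =
        inversion_prod (skew_sign D) v * minus_one_pow (int p + e * sum_list (map D (take p v)))"
      using inversion_prod_block[of "[0]" "map Suc v" ?D p] v
      by (simp add: take_map drop_map distinct_map comp_def del: map_map)
    then show "G (?I (map Suc (take p v) @ 0 # map Suc (drop p v))) (map Suc (take p v) @ 0 # map Suc (drop p v)) =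
        G (inversion_prod (skew_sign D) v * minus_one_pow (int p + e * sum_list (map D (take p v))))
        (map Suc (take p v) @ 0 # map Suc (drop p v))"
      by simp
  qed
  finally show ?thesis .
qed

subsection \<open>Multilinear maps\<close>

context vector_space
begin

lemma multilinear_map_add:
  assumes "multilinear_map scale k f" "length as + length bs + 1 = k"
  shows "f (as @ (x + y) # bs) = f (as @ x # bs) + f (as @ y # bs)"
  using assms(1)[unfolded multilinear_map_def, rule_format, of "as @ 0 # bs" "length as"] assms(2)
  by simp

lemma multilinear_map_scale:
  assumes "multilinear_map scale k f" "length as + length bs + 1 = k"
  shows "f (as @ scale c x # bs) = scale c (f (as @ x # bs))"
  using assms(1)[unfolded multilinear_map_def, rule_format, of "as @ 0 # bs" "length as"] assms(2)
  by simp

lemma multilinear_map_sum: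
  assumes "multilinear_map scale k f" "length as + length bs + 1 = k"
  shows "f (as @ (\<Sum>u\<in>U. g u) # bs) = (\<Sum>u\<in>U. f (as @ g u # bs))"
proof -
  \<comment> \<open>Covers empty and infinite \<open>U\<close>, over which both sums are 0.\<close>
  have zero: "f (as @ 0 # bs) = 0"
    using multilinear_map_scale[OF assms, of 0 0] by simp
  show ?thesis
  proof (induction U rule: infinite_finite_induct)
    case (insert u U)
    then show ?case using multilinear_map_add[OF assms] by simp
  qed (simp_all add: zero)
qed

end

subsection \<open>Skew-symmetrization in terms of words\<close>

context graded_vector_space
begin

text \<open>The labels need not form an initial segment; \<open>val\<close> and \<open>D\<close>
  supply their arguments and degrees. The inner operation can thus act on a subset of the arguments
  with signs taken in the original labels.\<close>

lemma skew_symmetrization_words: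
  assumes "multilinear_map scale (length L) (\<mu> (length L))" "sorted L" "distinct L"
    and "\<And>a. a \<in> set L \<Longrightarrow> val a \<in> A (D a)"
  shows "skew_symmetrization scale A \<mu> (length L) (map val L) =
    (\<Sum>w\<in>permutations_of_set (set L).
      scale (of_int (inversion_prod (skew_sign D) w)) (\<mu> (length L) (map val w)))"
proof -
  have "homogeneous A (map D L) (map val L)"
    using assms(4) by (simp add: homogeneous_def list_all2_conv_all_nth)
  then have "skew_symmetrization scale A \<mu> (length L) (map val L) =
      (\<Sum>\<sigma> | \<sigma> permutes {..<length L}.
        scale (of_int (chi (map D L) \<sigma>)) (\<mu> (length L) (map val (permute_list \<sigma> L))))"
    using skew_symmetrization_homogeneous[OF graded_vector_space_axioms, of "length L" \<mu>] assms(1)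
    by (auto simp: chi_def permute_list_map intro!: sum.cong)
  also have "\<dots> = (\<Sum>w\<in>permutations_of_set (set L).
      scale (of_int (inversion_prod (skew_sign D) w)) (\<mu> (length L) (map val w)))"
    using assms(2,3) by (rule sum_permutes_chi)
  finally show ?thesis .
qed

text \<open>Splits each ordering of the outer arguments into an order \<open>v\<close> of the
  original ones and the place \<open>p\<close> of \<open>y\<close>, which is the shape of a nested
  term in the associative identity.\<close>

lemma skew_symmetrization_Cons_words:
  fixes T :: "nat set"
  assumes "multilinear_map scale (Suc m) (\<mu> (Suc m))" "finite T" "card T = m"
    and "\<And>a. a \<in> T \<Longrightarrow> val a \<in> A (D a)" "y \<in> A e"
  shows "skew_symmetrization scale A \<mu> (Suc m) (y # map val (sorted_list_of_set T)) =
    (\<Sum>v\<in>permutations_of_set T. \<Sum>p\<le>m.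
      scale (of_int (inversion_prod (skew_sign D) v *
          minus_one_pow (int p + e * sum_list (map D (take p v)))))
        (\<mu> (Suc m) (map val (take p v) @ y # map val (drop p v))))"
proof -
  \<comment> \<open>Label 0 stands for \<open>y\<close>; the shift by \<open>Suc\<close> makes room
    for it and keeps the labels sorted.\<close>
  let ?L = "0 # map Suc (sorted_list_of_set T)"
  let ?val = "case_nat y val"
  have len: "length ?L = Suc m" and set: "set ?L = insert 0 (Suc ` T)"
    using assms by auto
  have "skew_symmetrization scale A \<mu> (length ?L) (map ?val ?L) =
      (\<Sum>w\<in>permutations_of_set (set ?L).
        scale (of_int (inversion_prod (skew_sign (case_nat e D)) w)) (\<mu> (length ?L) (map ?val w)))"
  proof (rule skew_symmetrization_words)
    show "sorted ?L" by (auto simp: sorted_map intro: sorted_wrt_mono_rel[OF _ sorted_sorted_list_of_set])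
  qed (use assms len in \<open>auto simp: distinct_map\<close>)
  also have "\<dots> = (\<Sum>v\<in>permutations_of_set T. \<Sum>p\<le>m.
      scale (of_int (inversion_prod (skew_sign D) v *
          minus_one_pow (int p + e * sum_list (map D (take p v)))))
        (\<mu> (length ?L) (map ?val (map Suc (take p v) @ 0 # map Suc (drop p v)))))"
    unfolding set using assms(2,3) by (rule sum_permutations_of_set_insert_zero)
  finally show ?thesis
    unfolding len by (simp add: comp_def)
qed

end

subsection \<open>Comparison of the two identities\<close>

context graded_vector_space
begin

text \<open>A shuffle, an inner permutation and an outer permutation become the data
  \<open>S\<close>, \<open>u\<close>, \<open>v\<close>, \<open>p\<close>. The coefficient is the
  product of their three signs and of \<open>c\<close>, which stays general here.\<close>

lemma L_infinity_term_words:
  fixes i m :: nat and xs :: "'a list"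
  defines "N \<equiv> {..<i + m}"
  assumes "1 \<le> i" "length xs = i + m" "homogeneous A d xs"
    and "multilinear_map scale i (\<mu>' i)" "has_degree A i (2 - int i) (\<mu>' i)"
    and "multilinear_map scale (Suc m) (\<mu> (Suc m))"
  shows "(\<Sum>\<sigma>\<in>shuffles_Sh i m. scale (of_int (chi d \<sigma> * c))
      (skew_symmetrization scale A \<mu> (Suc m)
        (skew_symmetrization scale A \<mu>' i (take i (permute_list \<sigma> xs)) # drop i (permute_list \<sigma> xs)))) =
    (\<Sum>S | S \<subseteq> N \<and> card S = i. \<Sum>u\<in>permutations_of_set S. \<Sum>v\<in>permutations_of_set (N - S). \<Sum>p\<le>m.
      scale (of_int (cross_prod (skew_sign ((!) d)) S (N - S) * c *
          (inversion_prod (skew_sign ((!) d)) v *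
            minus_one_pow (int p + (sum ((!) d) S + (2 - int i)) * sum_list (map ((!) d) (take p v)))) *
          inversion_prod (skew_sign ((!) d)) u))
        (\<mu> (Suc m) (map ((!) xs) (take p v) @ \<mu>' i (map ((!) xs) u) # map ((!) xs) (drop p v))))"
proof -
  let ?l = "skew_symmetrization scale A \<mu> (Suc m)" and ?l' = "skew_symmetrization scale A \<mu>' i"
  let ?D = "(!) d" and ?val = "(!) xs"
  let ?I = "inversion_prod (skew_sign ?D)" and ?C = "cross_prod (skew_sign ?D)"
  let ?F = "\<lambda>w. scale (of_int (?I w * c)) (?l (?l' (take i (map ?val w)) # drop i (map ?val w)))"
  have len: "length d = i + m" and hom: "\<And>a. a < i + m \<Longrightarrow> ?val a \<in> A (?D a)"
    using assms(3,4) by (auto simp: homogeneous_def list_all2_conv_all_nth)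
  have d: "map ?D [0..<i + m] = d" and xs: "map ?val [0..<i + m] = xs"
    using len assms(3) map_nth[of d] map_nth[of xs] by simp_all
  have "(\<Sum>\<sigma>\<in>shuffles_Sh i m. scale (of_int (chi d \<sigma> * c))
      (?l (?l' (take i (permute_list \<sigma> xs)) # drop i (permute_list \<sigma> xs)))) =
    (\<Sum>\<sigma>\<in>shuffles_Sh i m. ?F (permute_list \<sigma> [0..<i + m]))"
  proof (intro sum.cong refl)
    fix \<sigma> assume "\<sigma> \<in> shuffles_Sh i m"
    then have \<sigma>: "\<sigma> permutes {..<i + m}" by (simp add: shuffles_Sh_def)
    have "chi d \<sigma> = ?I (permute_list \<sigma> [0..<i + m])"
      using chi_word[of "[0..<i + m]" \<sigma> ?D] \<sigma> unfolding d by simp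
    moreover have "permute_list \<sigma> xs = map ?val (permute_list \<sigma> [0..<i + m])"
      using permute_list_map[of \<sigma> "[0..<i + m]" ?val] \<sigma> unfolding xs by simp
    ultimately show "scale (of_int (chi d \<sigma> * c))
        (?l (?l' (take i (permute_list \<sigma> xs)) # drop i (permute_list \<sigma> xs))) =
      ?F (permute_list \<sigma> [0..<i + m])"
      by simp
  qed
  also have "\<dots> = (\<Sum>S | S \<subseteq> N \<and> card S = i. ?F (sorted_list_of_set S @ sorted_list_of_set (N - S)))"
    unfolding N_def by (rule sum_shuffles_Sh)
  also have "\<dots> = (\<Sum>S | S \<subseteq> N \<and> card S = i. \<Sum>u\<in>permutations_of_set S.
      \<Sum>v\<in>permutations_of_set (N - S). \<Sum>p\<le>m.
      scale (of_int (?C S (N - S) * c *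
          (?I v * minus_one_pow (int p + (sum ?D S + (2 - int i)) * sum_list (map ?D (take p v)))) * ?I u))
        (\<mu> (Suc m) (map ?val (take p v) @ \<mu>' i (map ?val u) # map ?val (drop p v))))"
  proof (intro sum.cong refl)
    fix S assume "S \<in> {S. S \<subseteq> N \<and> card S = i}"
    then have S: "S \<subseteq> N" "card S = i" "finite S" "finite (N - S)" "card (N - S) = m"
      using finite_subset[of S N] by (auto simp: N_def card_Diff_subset)
    let ?y = "?l' (map ?val (sorted_list_of_set S))" and ?e = "sum ?D S + (2 - int i)"
    let ?g = "\<lambda>u. scale (of_int (?I u)) (\<mu>' i (map ?val u))"
    \<comment> \<open>Both blocks are increasing, so only the inversions between them
      remain.\<close>
    have I: "?I (sorted_list_of_set S @ sorted_list_of_set (N - S)) = ?C S (N - S)"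
      using S by (subst inversion_prod_append) (auto simp: inversion_prod_sorted)
    have val: "\<And>a. a \<in> N \<Longrightarrow> ?val a \<in> A (?D a)" using hom by (simp add: N_def)
    have y: "?y = (\<Sum>u\<in>permutations_of_set S. ?g u)"
      using skew_symmetrization_words[of "sorted_list_of_set S" \<mu>' ?val ?D] S assms(5) val by auto
    \<comment> \<open>The outer skew-symmetrization can be expanded by its formula only on
      homogeneous arguments, so the inner value must be shown to have degree
      \<open>?e\<close>.\<close>
    have "?g u \<in> A ?e" if "u \<in> permutations_of_set S" for u
    proof -
      have u: "set u = S" "distinct u" "length u = i"
        using that S by (auto simp: permutations_of_set_def distinct_card)
      have "homogeneous A (map ?D u) (map ?val u)"
        using val S(1) u(1) nth_mem by (fastforce simp: homogeneous_def list_all2_conv_all_nth)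
      then have "\<mu>' i (map ?val u) \<in> A (sum_list (map ?D u) + (2 - int i))"
        using assms(6) u unfolding has_degree_def by simp
      then show ?thesis
        using u subspace_scale[OF subspace_A] by (simp add: sum_list_distinct_conv_sum_set)
    qed
    then have "?y \<in> A ?e" unfolding y by (intro subspace_sum[OF subspace_A])
    then have "?l (?y # map ?val (sorted_list_of_set (N - S))) =
        (\<Sum>v\<in>permutations_of_set (N - S). \<Sum>p\<le>m.
          scale (of_int (?I v * minus_one_pow (int p + ?e * sum_list (map ?D (take p v)))))
            (\<mu> (Suc m) (map ?val (take p v) @ ?y # map ?val (drop p v))))"
      using S val assms(7) by (intro skew_symmetrization_Cons_words) auto
    also have "\<dots> = (\<Sum>v\<in>permutations_of_set (N - S). \<Sum>p\<le>m. \<Sum>u\<in>permutations_of_set S.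
          scale (of_int (?I v * minus_one_pow (int p + ?e * sum_list (map ?D (take p v))) * ?I u))
            (\<mu> (Suc m) (map ?val (take p v) @ \<mu>' i (map ?val u) # map ?val (drop p v))))"
    proof (intro sum.cong refl)
      fix v p assume "v \<in> permutations_of_set (N - S)" "p \<in> {..m}"
      \<comment> \<open>All slots but one are filled by \<open>v\<close>; linearity in the remaining
        slot pulls out the sum over \<open>u\<close> together with its signs.\<close>
      then have "length (map ?val (take p v)) + length (map ?val (drop p v)) + 1 = Suc m"
        using S by (auto simp: length_finite_permutations_of_set)
      note lin = multilinear_map_sum[OF assms(7) this] multilinear_map_scale[OF assms(7) this]
      show "scale (of_int (?I v * minus_one_pow (int p + ?e * sum_list (map ?D (take p v)))))
            (\<mu> (Suc m) (map ?val (take p v) @ ?y # map ?val (drop p v))) =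
          (\<Sum>u\<in>permutations_of_set S.
            scale (of_int (?I v * minus_one_pow (int p + ?e * sum_list (map ?D (take p v))) * ?I u))
            (\<mu> (Suc m) (map ?val (take p v) @ \<mu>' i (map ?val u) # map ?val (drop p v))))"
        unfolding y lin by (simp add: scale_sum_right)
    qed
    also have "\<dots> = (\<Sum>v\<in>permutations_of_set (N - S). \<Sum>u\<in>permutations_of_set S. \<Sum>p\<le>m.
          scale (of_int (?I v * minus_one_pow (int p + ?e * sum_list (map ?D (take p v))) * ?I u))
            (\<mu> (Suc m) (map ?val (take p v) @ \<mu>' i (map ?val u) # map ?val (drop p v))))"
      by (intro sum.cong refl sum.swap)
    also have "\<dots> = (\<Sum>u\<in>permutations_of_set S. \<Sum>v\<in>permutations_of_set (N - S). \<Sum>p\<le>m.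
          scale (of_int (?I v * minus_one_pow (int p + ?e * sum_list (map ?D (take p v))) * ?I u))
            (\<mu> (Suc m) (map ?val (take p v) @ \<mu>' i (map ?val u) # map ?val (drop p v))))"
      by (rule sum.swap)
    finally show "?F (sorted_list_of_set S @ sorted_list_of_set (N - S)) =
        (\<Sum>u\<in>permutations_of_set S. \<Sum>v\<in>permutations_of_set (N - S). \<Sum>p\<le>m.
          scale (of_int (?C S (N - S) * c *
              (?I v * minus_one_pow (int p + ?e * sum_list (map ?D (take p v)))) * ?I u))
            (\<mu> (Suc m) (map ?val (take p v) @ \<mu>' i (map ?val u) # map ?val (drop p v))))"
      unfolding I using S by (simp add: scale_sum_right mult.assoc)
  qed
  finally show ?thesis .
qed

text \<open>Cutting each word at the place of the inner operation produces the index data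
  \<open>S\<close>, \<open>u\<close>, \<open>v\<close>, \<open>p\<close> found on the other side.
  The weight \<open>f\<close> stays general until the signs are compared.\<close>

lemma A_infinity_term_words:
  fixes i m :: nat and val :: "nat \<Rightarrow> 'a" and \<mu> \<mu>' :: "nat \<Rightarrow> 'a list \<Rightarrow> 'a"
  defines "N \<equiv> {..<i + m}"
  shows "(\<Sum>w\<in>permutations_of_set N. scale (of_int (f w)) (\<Sum>l = 1..Suc m.
      scale (of_int (minus_one_pow
            (int (l * (i + 1) + i * Suc m) + int i * sum_list (take (l - 1) (map D w)))))
          (\<mu> (Suc m) (take (l - 1) (map val w) @ [\<mu>' i (take i (drop (l - 1) (map val w)))] @
            drop (l - 1 + i) (map val w))))) =
    (\<Sum>S | S \<subseteq> N \<and> card S = i. \<Sum>u\<in>permutations_of_set S. \<Sum>v\<in>permutations_of_set (N - S). \<Sum>p\<le>m.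
      scale (of_int (f (take p v @ u @ drop p v) * minus_one_pow
            (int (Suc p * (i + 1) + i * Suc m) + int i * sum_list (map D (take p v)))))
        (\<mu> (Suc m) (map val (take p v) @ \<mu>' i (map val u) # map val (drop p v))))"
proof -
  let ?G = "\<lambda>p w. scale (of_int (f w * minus_one_pow
      (int (Suc p * (i + 1) + i * Suc m) + int i * sum_list (take p (map D w)))))
    (\<mu> (Suc m) (take p (map val w) @ [\<mu>' i (take i (drop p (map val w)))] @ drop (p + i) (map val w)))"
  have "(\<Sum>w\<in>permutations_of_set N. scale (of_int (f w)) (\<Sum>l = 1..Suc m.
      scale (of_int (minus_one_pow
            (int (l * (i + 1) + i * Suc m) + int i * sum_list (take (l - 1) (map D w)))))
          (\<mu> (Suc m) (take (l - 1) (map val w) @ [\<mu>' i (take i (drop (l - 1) (map val w)))] @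
            drop (l - 1 + i) (map val w))))) =
      (\<Sum>w\<in>permutations_of_set N. \<Sum>p\<le>m. ?G p w)"
    \<comment> \<open>The place \<open>l\<close> is counted from 1 and \<open>p\<close> from 0, so
      \<open>l = Suc p\<close>.\<close>
    by (simp only: One_nat_def sum.atLeast1_atMost_eq lessThan_Suc_atMost scale_sum_right
      scale_scale of_int_mult diff_Suc_Suc diff_zero)
  also have "\<dots> = (\<Sum>p\<le>m. \<Sum>w\<in>permutations_of_set N. ?G p w)"
    by (rule sum.swap)
  \<comment> \<open>How a word is decomposed depends on the cut position, so the sum over
    \<open>p\<close> is kept outside here and moved back in afterwards.\<close>
  also have "\<dots> = (\<Sum>p\<le>m. \<Sum>S | S \<subseteq> N \<and> card S = i. \<Sum>u\<in>permutations_of_set S.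
      \<Sum>v\<in>permutations_of_set (N - S). ?G p (take p v @ u @ drop p v))"
    by (intro sum.cong refl sum_permutations_of_set_block) (auto simp: N_def)
  also have "\<dots> = (\<Sum>S | S \<subseteq> N \<and> card S = i. \<Sum>u\<in>permutations_of_set S.
      \<Sum>v\<in>permutations_of_set (N - S). \<Sum>p\<le>m. ?G p (take p v @ u @ drop p v))"
    by (subst sum.swap, intro sum.cong refl, subst sum.swap, intro sum.cong refl, rule sum.swap)
  also have "\<dots> = (\<Sum>S | S \<subseteq> N \<and> card S = i. \<Sum>u\<in>permutations_of_set S. \<Sum>v\<in>permutations_of_set (N - S). \<Sum>p\<le>m.
      scale (of_int (f (take p v @ u @ drop p v) * minus_one_pow
            (int (Suc p * (i + 1) + i * Suc m) + int i * sum_list (map D (take p v)))))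
        (\<mu> (Suc m) (map val (take p v) @ \<mu>' i (map val u) # map val (drop p v))))"
  proof (intro sum.cong refl)
    fix S u v p
    assume *: "S \<in> {S. S \<subseteq> N \<and> card S = i}" "u \<in> permutations_of_set S"
      "v \<in> permutations_of_set (N - S)" "p \<in> {..m}"
    then have "finite S" using finite_subset[of S N] by (simp add: N_def)
    then have "length u = i" "length (take p v) = p"
      using * by (auto simp: length_finite_permutations_of_set card_Diff_subset N_def)
    then show "?G p (take p v @ u @ drop p v) =
        scale (of_int (f (take p v @ u @ drop p v) * minus_one_pow
            (int (Suc p * (i + 1) + i * Suc m) + int i * sum_list (map D (take p v)))))
        (\<mu> (Suc m) (map val (take p v) @ \<mu>' i (map val u) # map val (drop p v)))"
      by (simp flip: take_map drop_map)
  qed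
  finally show ?thesis .
qed

text \<open>Once both sides are sums over \<open>S\<close>, \<open>u\<close>, \<open>v\<close>,
  \<open>p\<close> of the same vectors, only coefficients have to be compared. The global minus sign
  is the odd constant left by counting the places \<open>l\<close> from 1.\<close>

lemma L_infinity_term_eq:
  fixes i m :: nat and xs :: "'a list"
  assumes "1 \<le> i" "length xs = i + m" "homogeneous A d xs"
    and "multilinear_map scale i (\<mu>' i)" "has_degree A i (2 - int i) (\<mu>' i)"
    and "multilinear_map scale (Suc m) (\<mu> (Suc m))"
  shows "(\<Sum>\<sigma>\<in>shuffles_Sh i m. scale (of_int (chi d \<sigma> * minus_one_pow (int i * int m)))
      (skew_symmetrization scale A \<mu> (Suc m)
        (skew_symmetrization scale A \<mu>' i (take i (permute_list \<sigma> xs)) # drop i (permute_list \<sigma> xs)))) =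
    - (\<Sum>w\<in>permutations_of_set {..<i + m}. scale (of_int (inversion_prod (skew_sign ((!) d)) w))
        (\<Sum>l = 1..Suc m. scale (of_int (minus_one_pow
            (int (l * (i + 1) + i * Suc m) + int i * sum_list (take (l - 1) (map ((!) d) w)))))
          (\<mu> (Suc m) (take (l - 1) (map ((!) xs) w) @ [\<mu>' i (take i (drop (l - 1) (map ((!) xs) w)))] @
            drop (l - 1 + i) (map ((!) xs) w)))))"
  unfolding L_infinity_term_words[where \<mu> = \<mu> and \<mu>' = \<mu>', OF assms] A_infinity_term_words sum_negf[symmetric]
    scale_minus_left[symmetric]
proof (intro sum.cong refl arg_cong2[where f = scale])
  fix S u v p
  let ?D = "(!) d"
  let ?I = "inversion_prod (skew_sign ?D)" and ?C = "cross_prod (skew_sign ?D)"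
  assume *: "S \<in> {S. S \<subseteq> {..<i + m} \<and> card S = i}" "u \<in> permutations_of_set S"
    "v \<in> permutations_of_set ({..<i + m} - S)" "p \<in> {..m}"
  then have u: "set u = S" "distinct u" "length u = i" and v: "set v = {..<i + m} - S" "distinct v"
    and fin: "finite S"
    using finite_subset[of S "{..<i + m}"]
    by (auto simp: permutations_of_set_def distinct_card)
  have p: "length (take p v) = p"
    using * fin by (auto simp: length_finite_permutations_of_set card_Diff_subset)
  define s where "s = sum ?D S"
  define t where "t = sum_list (map ?D (take p v))"
  have s: "sum_list (map ?D u) = s"
    using u by (simp add: s_def sum_list_distinct_conv_sum_set)
  have "minus_one_pow (int i * int m) * minus_one_pow (int p + (s + (2 - int i)) * t) =
      minus_one_pow (int i * int m + (int p + (s + (2 - int i)) * t))"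
    by (simp add: minus_one_pow_add)
  \<comment> \<open>The exponents differ by an even number: on the right \<open>i * p\<close> and
    \<open>i\<close> each occur twice and the constants add up to 2, while the terms
    \<open>i * t\<close> on the two sides have opposite signs.\<close>
  also have "\<dots> = minus_one_pow (1 + (int i * int p + s * t) +
      (int (Suc p * (i + 1) + i * Suc m) + int i * t))"
    by (rule minus_one_pow_cong) (simp add: algebra_simps)
  also have "\<dots> = - (minus_one_pow (int i * int p + s * t) *
      minus_one_pow (int (Suc p * (i + 1) + i * Suc m) + int i * t))"
    unfolding minus_one_pow_add by (simp add: minus_one_pow_def)
  finally have sign: "minus_one_pow (int i * int m) * minus_one_pow (int p + (s + (2 - int i)) * t) = \<dots>" .
  have "?I (take p v @ u @ drop p v) = ?I u * ?I v * ?C S ({..<i + m} - S) *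
      minus_one_pow (int i * int p + s * t)"
    using inversion_prod_block[of u v ?D p] u v p s by (auto simp: t_def)
  then have "?C S ({..<i + m} - S) * minus_one_pow (int i * int m) *
      (?I v * minus_one_pow (int p + (s + (2 - int i)) * t)) * ?I u =
      - (?I (take p v @ u @ drop p v) * minus_one_pow (int (Suc p * (i + 1) + i * Suc m) + int i * t))"
    using arg_cong[OF sign, of "\<lambda>x. ?C S ({..<i + m} - S) * ?I v * ?I u * x"]
    by (simp only: mult_ac mult_minus_left mult_minus_right)
  then show "(of_int (?C S ({..<i + m} - S) * minus_one_pow (int i * int m) *
      (?I v * minus_one_pow (int p + (sum ?D S + (2 - int i)) * sum_list (map ?D (take p v)))) * ?I u) :: 'k) =
      - of_int (?I (take p v @ u @ drop p v) * minus_one_pow (int (Suc p * (i + 1) + i * Suc m) +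
        int i * sum_list (map ?D (take p v))))"
    unfolding s_def t_def by (simp only: of_int_minus)
qed

end

context graded_vector_space
begin

subsection \<open>Skew-symmetrizations are skew-symmetric multilinear maps\<close>

lemma hom_component:
  shows hom_component_finite: "finite {i. hom_component A x i \<noteq> 0}"
    and hom_component_in: "hom_component A x i \<in> A i"
    and hom_component_sum: "x = (\<Sum>i | hom_component A x i \<noteq> 0. hom_component A x i)"
  using theI'[OF direct_sum[of x], folded hom_component_def] by blast+

text \<open>\<open>F\<close> only has to contain the support of \<open>f\<close>. A union of
  supports therefore serves for a sum of two vectors even where components cancel.\<close>

lemma hom_component_unique:
  assumes "finite F" "\<And>i. f i \<in> A i" "\<And>i. i \<notin> F \<Longrightarrow> f i = 0" "x = (\<Sum>i\<in>F. f i)"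
  shows "hom_component A x = f"
proof -
  have sub: "{i. f i \<noteq> 0} \<subseteq> F" using assms(3) by auto
  then have "(\<Sum>i | f i \<noteq> 0. f i) = (\<Sum>i\<in>F. f i)"
    using assms(1) by (intro sum.mono_neutral_left) auto
  with assms(2,4) finite_subset[OF sub assms(1)] show ?thesis
    unfolding hom_component_def by (intro the1_equality direct_sum) auto
qed

lemma hom_component_sum_superset:
  assumes "finite F" "{i. hom_component A x i \<noteq> 0} \<subseteq> F"
  shows "x = (\<Sum>i\<in>F. hom_component A x i)"
proof -
  have "(\<Sum>i | hom_component A x i \<noteq> 0. hom_component A x i) = (\<Sum>i\<in>F. hom_component A x i)"
    using assms by (intro sum.mono_neutral_left) auto
  then show ?thesis using hom_component_sum[of x] by simp
qed

lemma hom_component_add: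
  "hom_component A (x + y) i = hom_component A x i + hom_component A y i"
proof -
  let ?F = "{i. hom_component A x i \<noteq> 0} \<union> {i. hom_component A y i \<noteq> 0}"
  have "hom_component A (x + y) = (\<lambda>i. hom_component A x i + hom_component A y i)"
  proof (rule hom_component_unique)
    show "finite ?F" by (simp add: hom_component_finite)
    then show "x + y = (\<Sum>i\<in>?F. hom_component A x i + hom_component A y i)"
      using hom_component_sum_superset[of ?F x] hom_component_sum_superset[of ?F y]
      by (simp add: sum.distrib)
  qed (auto intro: subspace_add[OF subspace_A] hom_component_in)
  then show ?thesis by simp
qed

lemma hom_component_scale: "hom_component A (scale c x) i = scale c (hom_component A x i)"
proof -
  let ?F = "{i. hom_component A x i \<noteq> 0}"
  have "hom_component A (scale c x) = (\<lambda>i. scale c (hom_component A x i))"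
  proof (rule hom_component_unique)
    show "scale c x = (\<Sum>i\<in>?F. scale c (hom_component A x i))"
      using hom_component_sum[of x] by (simp flip: scale_sum_right)
  qed (auto intro: subspace_scale[OF subspace_A] hom_component_in simp: hom_component_finite)
  then show ?thesis by simp
qed

text \<open>A surplus degree list puts a zero component into some slot, where the multilinear
  \<open>\<mu> k\<close> vanishes. Different argument lists can thus be compared over one index
  set.\<close>

lemma skew_symmetrization_superset:
  assumes "multilinear_map scale k (\<mu> k)" "length xs = k" "finite F"
    and "\<And>x. x \<in> set xs \<Longrightarrow> {i. hom_component A x i \<noteq> 0} \<subseteq> F"
  shows "skew_symmetrization scale A \<mu> k xs =
    (\<Sum>d | set d \<subseteq> F \<and> length d = k. \<Sum>\<sigma> | \<sigma> permutes {..<k}.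
      scale (of_int (chi d \<sigma>)) (\<mu> k (permute_list \<sigma> (map2 (hom_component A) xs d))))"
  unfolding skew_symmetrization_def chi_def
proof (rule sum.mono_neutral_left)
  show "finite {d. set d \<subseteq> F \<and> length d = k}"
    using assms(3) by (rule finite_lists_length_eq)
  show "{d. list_all2 (\<lambda>x i. hom_component A x i \<noteq> 0) xs d} \<subseteq> {d. set d \<subseteq> F \<and> length d = k}"
    using assms(2,4) by (fastforce simp: list_all2_conv_all_nth in_set_conv_nth)
  show "\<forall>d\<in>{d. set d \<subseteq> F \<and> length d = k} - {d. list_all2 (\<lambda>x i. hom_component A x i \<noteq> 0) xs d}.
      (\<Sum>\<sigma> | \<sigma> permutes {..<k}. scale (of_int (sign \<sigma> * koszul_sign d \<sigma>))
        (\<mu> k (permute_list \<sigma> (map2 (hom_component A) xs d)))) = 0"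
  proof (intro ballI sum.neutral)
    fix d \<sigma>
    assume d: "d \<in> {d. set d \<subseteq> F \<and> length d = k} - {d. list_all2 (\<lambda>x i. hom_component A x i \<noteq> 0) xs d}"
      and \<sigma>: "\<sigma> \<in> {\<sigma>. \<sigma> permutes {..<k}}"
    from d obtain q where "q < k" "hom_component A (xs ! q) (d ! q) = 0"
      using assms(2) by (auto simp: list_all2_conv_all_nth)
    then have "map2 (hom_component A) xs d ! q = 0" "q < length (map2 (hom_component A) xs d)"
      using d assms(2) by auto
    then have "0 \<in> set (map2 (hom_component A) xs d)" by (metis nth_mem)
    moreover have "length (map2 (hom_component A) xs d) = k" using d assms(2) by auto
    ultimately have "\<mu> k (permute_list \<sigma> (map2 (hom_component A) xs d)) = 0"
      using \<sigma> assms(1) by (intro multilinear_map_zero[OF vector_space_axioms]) auto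
    then show "scale (of_int (sign \<sigma> * koszul_sign d \<sigma>))
        (\<mu> k (permute_list \<sigma> (map2 (hom_component A) xs d))) = 0" by simp
  qed
qed

text \<open>Locates the slot where argument \<open>p\<close> ends up, so that linearity of the
  original operation can be applied there.\<close>

lemma permute_list_update:
  assumes "\<sigma> permutes {..<length xs}" "p < length xs"
  shows "permute_list \<sigma> (xs[p := z]) = (permute_list \<sigma> xs)[inv \<sigma> p := z]"
proof (rule nth_equalityI)
  fix q assume "q < length (permute_list \<sigma> (xs[p := z]))"
  then have q: "q < length xs" by simp
  then have "\<sigma> q < length xs" using permutes_in_image[OF assms(1), of q] by simp
  moreover have "inv \<sigma> p = q \<longleftrightarrow> \<sigma> q = p" using assms(1) by (rule permutes_inv_eq)
  moreover have "inv \<sigma> p < length xs"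
    using permutes_in_image[OF permutes_inv[OF assms(1)], of p] assms(2) by simp
  ultimately show "permute_list \<sigma> (xs[p := z]) ! q = (permute_list \<sigma> xs)[inv \<sigma> p := z] ! q"
    using assms q by (simp add: permute_list_nth nth_list_update eq_commute[of p])
qed simp

lemma multilinear_map_skew_symmetrization:
  assumes "multilinear_map scale k (\<mu> k)"
  shows "multilinear_map scale k (skew_symmetrization scale A \<mu> k)"
  unfolding multilinear_map_def
proof (intro allI impI)
  fix xs :: "'a list" and p
  assume xs: "length xs = k" and p: "p < k"
  let ?l = "skew_symmetrization scale A \<mu> k"
  \<comment> \<open>\<open>T\<close> isolates the dependence on the new argument \<open>z\<close> in
    a single slot of \<open>\<mu> k\<close>.\<close>
  define T where "T z d \<sigma> = scale (of_int (chi d \<sigma>))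
      (\<mu> k ((permute_list \<sigma> (map2 (hom_component A) xs d))[inv \<sigma> p := hom_component A z (d ! p)]))"
    for z d \<sigma>
  \<comment> \<open>\<open>Z\<close> adds further vectors to the support, so that the same
    \<open>F\<close> serves for \<open>x\<close>, \<open>y\<close> and \<open>x + y\<close>, or for
    \<open>x\<close> and its multiple.\<close>
  have expand: "?l (xs[p := z]) = (\<Sum>d | set d \<subseteq> F \<and> length d = k. \<Sum>\<sigma> | \<sigma> permutes {..<k}. T z d \<sigma>)"
    if F: "F = (\<Union>x\<in>insert z (set xs \<union> Z). {i. hom_component A x i \<noteq> 0})" and Z: "finite Z"
    for z F Z
  proof -
    have "?l (xs[p := z]) = (\<Sum>d | set d \<subseteq> F \<and> length d = k. \<Sum>\<sigma> | \<sigma> permutes {..<k}.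
        scale (of_int (chi d \<sigma>)) (\<mu> k (permute_list \<sigma> (map2 (hom_component A) (xs[p := z]) d))))"
    proof (rule skew_symmetrization_superset[where \<mu> = \<mu>, OF assms])
      show "finite F" unfolding F using Z by (auto simp: hom_component_finite)
      fix x assume "x \<in> set (xs[p := z])"
      then have "x \<in> insert z (set xs \<union> Z)" using set_update_subset_insert by fastforce
      then show "{i. hom_component A x i \<noteq> 0} \<subseteq> F" unfolding F by blast
    qed (simp add: xs)
    also have "\<dots> = (\<Sum>d | set d \<subseteq> F \<and> length d = k. \<Sum>\<sigma> | \<sigma> permutes {..<k}. T z d \<sigma>)"
    proof (intro sum.cong refl)
      fix d \<sigma> assume "d \<in> {d. set d \<subseteq> F \<and> length d = k}" "\<sigma> \<in> {\<sigma>. \<sigma> permutes {..<k}}"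
      then have d: "length d = k" and \<sigma>: "\<sigma> permutes {..<k}" by auto
      have "map2 (hom_component A) (xs[p := z]) d = (map2 (hom_component A) xs d)[p := hom_component A z (d ! p)]"
        using xs d p by (intro nth_equalityI) (auto simp: nth_list_update)
      then show "scale (of_int (chi d \<sigma>)) (\<mu> k (permute_list \<sigma> (map2 (hom_component A) (xs[p := z]) d))) =
          T z d \<sigma>"
        using xs d \<sigma> p by (simp add: T_def permute_list_update)
    qed
    finally show ?thesis .
  qed
  have lin: "T (x + y) d \<sigma> = T x d \<sigma> + T y d \<sigma>" "T (scale c x) d \<sigma> = scale c (T x d \<sigma>)"
    if "\<sigma> permutes {..<k}" "length d = k" for x y c d \<sigma>
  proof -
    have *: "inv \<sigma> p < k" using permutes_in_image[OF permutes_inv[OF that(1)], of p] p by simp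
    have **: "length (permute_list \<sigma> (map2 (hom_component A) xs d)) = k"
      using xs that(2) by simp
    note ml = assms[unfolded multilinear_map_def, rule_format, OF ** *]
    show "T (x + y) d \<sigma> = T x d \<sigma> + T y d \<sigma>"
      using ml by (simp add: T_def hom_component_add scale_right_distrib)
    show "T (scale c x) d \<sigma> = scale c (T x d \<sigma>)"
      using ml by (simp add: T_def hom_component_scale mult.commute)
  qed
  have add: "?l (xs[p := x + y]) = ?l (xs[p := x]) + ?l (xs[p := y])" for x y
  proof -
    let ?F = "\<Union>z\<in>set xs \<union> {x, y, x + y}. {i. hom_component A z i \<noteq> 0}"
    have eq: "?l (xs[p := z]) = (\<Sum>d | set d \<subseteq> ?F \<and> length d = k. \<Sum>\<sigma> | \<sigma> permutes {..<k}. T z d \<sigma>)"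
      if "z \<in> {x, y, x + y}" for z
      using that by (intro expand[where Z = "{x, y, x + y}"]) auto
    have "?l (xs[p := x + y]) =
        (\<Sum>d | set d \<subseteq> ?F \<and> length d = k. \<Sum>\<sigma> | \<sigma> permutes {..<k}. T x d \<sigma> + T y d \<sigma>)"
      by (subst eq, simp, intro sum.cong refl lin) auto
    then show ?thesis by (simp only: eq insertI1 insertI2 sum.distrib)
  qed
  have scale: "?l (xs[p := scale c x]) = scale c (?l (xs[p := x]))" for c x
  proof -
    let ?F = "\<Union>z\<in>set xs \<union> {x, scale c x}. {i. hom_component A z i \<noteq> 0}"
    have eq: "?l (xs[p := z]) = (\<Sum>d | set d \<subseteq> ?F \<and> length d = k. \<Sum>\<sigma> | \<sigma> permutes {..<k}. T z d \<sigma>)"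
      if "z \<in> {x, scale c x}" for z
      using that by (intro expand[where Z = "{x, scale c x}"]) auto
    have "?l (xs[p := scale c x]) =
        (\<Sum>d | set d \<subseteq> ?F \<and> length d = k. \<Sum>\<sigma> | \<sigma> permutes {..<k}. scale c (T x d \<sigma>))"
      by (subst eq, simp, intro sum.cong refl lin) auto
    then show ?thesis by (simp only: eq insertI1 scale_sum_right)
  qed
  show "(\<forall>x y. ?l (xs[p := x + y]) = ?l (xs[p := x]) + ?l (xs[p := y])) \<and>
      (\<forall>c x. ?l (xs[p := scale c x]) = scale c (?l (xs[p := x])))"
    using add scale by blast
qed

lemma homogeneous_permute_list:
  assumes "homogeneous A d xs" "\<sigma> permutes {..<length xs}"
  shows "homogeneous A (permute_list \<sigma> d) (permute_list \<sigma> xs)"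
  using assms list_all2_lengthD[of _ d xs]
  by (auto simp: homogeneous_def list_all2_permute_list_iff)

text \<open>Permuting the arguments rearranges the summands of the total degree, and each graded
  piece is a subspace.\<close>

lemma has_degree_skew_symmetrization:
  assumes "multilinear_map scale k (\<mu> k)" "has_degree A k e (\<mu> k)"
  shows "has_degree A k e (skew_symmetrization scale A \<mu> k)"
  unfolding has_degree_def
proof (intro allI impI)
  fix d xs assume xs: "length xs = k" and hom: "homogeneous A d xs"
  have d: "length d = k" using hom xs by (auto simp: homogeneous_def list_all2_lengthD)
  have "\<mu> k (permute_list \<sigma> xs) \<in> A (sum_list d + e)" if "\<sigma> permutes {..<k}" for \<sigma>
  proof -
    have "sum_list (permute_list \<sigma> d) = sum_list d"
      using that d by (metis mset_permute_list sum_mset_sum_list)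
    moreover have "\<mu> k (permute_list \<sigma> xs) \<in> A (sum_list (permute_list \<sigma> d) + e)"
      using assms(2) homogeneous_permute_list[OF hom] that xs by (auto simp: has_degree_def)
    ultimately show ?thesis by simp
  qed
  then show "skew_symmetrization scale A \<mu> k xs \<in> A (sum_list d + e)"
    unfolding skew_symmetrization_homogeneous[where \<mu> = \<mu>, OF graded_vector_space_axioms assms(1) xs hom]
    by (intro subspace_sum[OF subspace_A] subspace_scale[OF subspace_A]) auto
qed

text \<open>Replacing \<open>\<tau>\<close> by \<open>\<sigma> \<circ> \<tau>\<close> permutes the
  summands, and the crossed homomorphism rule for \<open>chi\<close> extracts the constant factor
  \<open>chi d \<sigma>\<close>.\<close>

lemma skew_symmetric_skew_symmetrization:
  assumes "multilinear_map scale k (\<mu> k)"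
  shows "skew_symmetric scale A k (skew_symmetrization scale A \<mu> k)"
  unfolding skew_symmetric_def
proof (intro allI impI)
  fix d xs \<sigma>
  assume xs: "length xs = k" and hom: "homogeneous A d xs" and \<sigma>: "\<sigma> permutes {..<k}"
  let ?G = "\<lambda>\<tau>. scale (of_int (chi d \<tau>)) (\<mu> k (permute_list \<tau> xs))"
  have d: "length d = k" using hom xs by (auto simp: homogeneous_def list_all2_lengthD)
  have l: "skew_symmetrization scale A \<mu> k ys =
      (\<Sum>\<tau> | \<tau> permutes {..<k}. scale (of_int (chi e \<tau>)) (\<mu> k (permute_list \<tau> ys)))"
    if "length ys = k" "homogeneous A e ys" for e ys
    using skew_symmetrization_homogeneous[where \<mu> = \<mu>, OF graded_vector_space_axioms assms that]
    by (simp add: chi_def)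
  have "skew_symmetrization scale A \<mu> k (permute_list \<sigma> xs) =
      (\<Sum>\<tau> | \<tau> permutes {..<k}.
        scale (of_int (chi (permute_list \<sigma> d) \<tau>)) (\<mu> k (permute_list \<tau> (permute_list \<sigma> xs))))"
    using xs \<sigma> homogeneous_permute_list[OF hom] by (intro l) auto
  also have "\<dots> = (\<Sum>\<tau> | \<tau> permutes {..<k}. scale (of_int (chi d \<sigma>)) (?G (\<sigma> \<circ> \<tau>)))"
  proof (intro sum.cong refl)
    fix \<tau> assume "\<tau> \<in> {\<tau>. \<tau> permutes {..<k}}"
    then have \<tau>: "\<tau> permutes {..<k}" by simp
    \<comment> \<open>The composition rule multiplied by \<open>chi d \<sigma>\<close>, which
      squares to 1.\<close>
    have "chi d \<sigma> * chi d (\<sigma> \<circ> \<tau>) = chi (permute_list \<sigma> d) \<tau>"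
      using chi_compose[of \<sigma> d \<tau>] chi_square[of \<sigma> d] \<sigma> \<tau> d by (simp flip: mult.assoc)
    then show "scale (of_int (chi (permute_list \<sigma> d) \<tau>)) (\<mu> k (permute_list \<tau> (permute_list \<sigma> xs))) =
        scale (of_int (chi d \<sigma>)) (?G (\<sigma> \<circ> \<tau>))"
      using \<tau> xs by (simp add: permute_list_compose flip: of_int_mult)
  qed
  also have "\<dots> = scale (of_int (chi d \<sigma>)) (\<Sum>\<tau> | \<tau> permutes {..<k}. ?G (\<sigma> \<circ> \<tau>))"
    by (rule scale_sum_right[symmetric])
  also have "(\<Sum>\<tau> | \<tau> permutes {..<k}. ?G (\<sigma> \<circ> \<tau>)) = (\<Sum>\<tau> | \<tau> permutes {..<k}. ?G \<tau>)"
    using setum_permutations_compose_left[OF \<sigma>, of ?G] by simp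
  also have "\<dots> = skew_symmetrization scale A \<mu> k xs"
    using l[OF xs hom] by simp
  finally show "skew_symmetrization scale A \<mu> k (permute_list \<sigma> xs) =
      scale (of_int (chi d \<sigma>)) (skew_symmetrization scale A \<mu> k xs)" .
qed

end

subsection \<open>The \<open>L\<^sub>\<infinity>\<close> identities\<close>

text \<open>The bilinear expression \<open>J\<close>: separating outer and inner operations gives a
  name to the mixed terms.\<close>

definition A_infinity_sum ::
  "('k::field \<Rightarrow> 'a::ab_group_add \<Rightarrow> 'a) \<Rightarrow> (nat \<Rightarrow> 'a list \<Rightarrow> 'a) \<Rightarrow> (nat \<Rightarrow> 'a list \<Rightarrow> 'a) \<Rightarrow>
    nat \<Rightarrow> int list \<Rightarrow> 'a list \<Rightarrow> 'a" where
  "A_infinity_sum scale \<mu> \<mu>' n d as =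
    (\<Sum>(i, j) | 1 \<le> i \<and> 1 \<le> j \<and> i + j = n + 1. \<Sum>l = 1..j.
        scale (of_int (minus_one_pow
            (int (l * (i + 1) + i * j) + int i * sum_list (take (l - 1) d))))
          (\<mu> j (take (l - 1) as @ [\<mu>' i (take i (drop (l - 1) as))] @ drop (l - 1 + i) as)))"

context graded_vector_space
begin

text \<open>The words on \<open>n\<close> letters do not depend on how \<open>n + 1\<close> splits
  into \<open>i + j\<close>, so the comparison for fixed \<open>i\<close> and \<open>j\<close> can
  be summed with the words outside.\<close>

lemma L_infinity_sum_skew_symmetrization:
  assumes "length xs = n" "homogeneous A d xs"
    and "\<And>k. 1 \<le> k \<Longrightarrow> multilinear_map scale k (\<mu> k)"
    and "\<And>k. 1 \<le> k \<Longrightarrow> multilinear_map scale k (\<mu>' k)"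
    and "\<And>k. 1 \<le> k \<Longrightarrow> has_degree A k (2 - int k) (\<mu>' k)"
  shows "L_infinity_sum scale (skew_symmetrization scale A \<mu>) (skew_symmetrization scale A \<mu>') n d xs =
    - (\<Sum>w\<in>permutations_of_set {..<n}. scale (of_int (inversion_prod (skew_sign ((!) d)) w))
        (A_infinity_sum scale \<mu> \<mu>' n (map ((!) d) w) (map ((!) xs) w)))"
proof -
  let ?P = "{(i, j). 1 \<le> i \<and> 1 \<le> j \<and> i + j = n + 1}"
  let ?T = "\<lambda>i j w. scale (of_int (inversion_prod (skew_sign ((!) d)) w))
        (\<Sum>l = 1..j. scale (of_int (minus_one_pow
            (int (l * (i + 1) + i * j) + int i * sum_list (take (l - 1) (map ((!) d) w)))))
          (\<mu> j (take (l - 1) (map ((!) xs) w) @ [\<mu>' i (take i (drop (l - 1) (map ((!) xs) w)))] @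
            drop (l - 1 + i) (map ((!) xs) w))))"
  have "L_infinity_sum scale (skew_symmetrization scale A \<mu>) (skew_symmetrization scale A \<mu>') n d xs =
      (\<Sum>(i, j)\<in>?P. - (\<Sum>w\<in>permutations_of_set {..<n}. ?T i j w))"
    unfolding L_infinity_sum_def
  proof (intro sum.cong refl, clarify)
    fix i j assume ij: "(1::nat) \<le> i" "(1::nat) \<le> j" "i + j = n + 1"
    \<comment> \<open>\<open>m\<close> counts the arguments outside the inner block; the inner value
      is the remaining argument of the outer operation.\<close>
    then obtain m where m: "j = Suc m" by (cases j) auto
    then have n: "n = i + m" "n - i = m" "int j - 1 = int m" using ij by auto
    show "(\<Sum>\<sigma>\<in>shuffles_Sh i (n - i). scale (of_int (chi d \<sigma> * minus_one_pow (int i * (int j - 1))))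
        (skew_symmetrization scale A \<mu> j (skew_symmetrization scale A \<mu>' i (take i (permute_list \<sigma> xs)) #
          drop i (permute_list \<sigma> xs)))) = - (\<Sum>w\<in>permutations_of_set {..<n}. ?T i j w)"
      unfolding n(2,3) unfolding n(1) m
      using assms ij n by (intro L_infinity_term_eq) auto
  qed
  also have "\<dots> = - (\<Sum>(i, j)\<in>?P. \<Sum>w\<in>permutations_of_set {..<n}. ?T i j w)"
    by (simp add: sum_negf case_prod_beta)
  also have "(\<Sum>(i, j)\<in>?P. \<Sum>w\<in>permutations_of_set {..<n}. ?T i j w) =
      (\<Sum>w\<in>permutations_of_set {..<n}. \<Sum>(i, j)\<in>?P. ?T i j w)"
    unfolding case_prod_beta by (rule sum.swap)
  finally show ?thesis
    by (simp add: A_infinity_sum_def scale_sum_right case_prod_beta)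
qed

text \<open>Additivity in the outer family is pointwise; in the inner family it is linearity of the
  outer operations in the slot of the inserted value.\<close>

lemma A_infinity_sum_add:
  assumes "length as = n"
    and "\<And>k. 1 \<le> k \<Longrightarrow> multilinear_map scale k (\<mu> k)"
    and "\<And>k. 1 \<le> k \<Longrightarrow> multilinear_map scale k (\<mu>' k)"
  shows "A_infinity_sum scale (\<lambda>k as. \<mu> k as + \<mu>' k as) (\<lambda>k as. \<mu> k as + \<mu>' k as) n d as =
    A_infinity_sum scale \<mu> \<mu> n d as + A_infinity_sum scale \<mu> \<mu>' n d as +
    (A_infinity_sum scale \<mu>' \<mu> n d as + A_infinity_sum scale \<mu>' \<mu>' n d as)"
  unfolding A_infinity_sum_def sum.distrib[symmetric]
proof (intro sum.cong refl, clarify, unfold prod.case sum.distrib[symmetric], intro sum.cong refl)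
  fix i j l assume ij: "(1::nat) \<le> i" "(1::nat) \<le> j" "i + j = n + 1" and l: "l \<in> {1..j}"
  \<comment> \<open>Since \<open>i + j = n + 1\<close>, replacing a block of \<open>i\<close>
    arguments by one value leaves exactly \<open>j\<close> of them.\<close>
  have len: "length (take (l - 1) as) + length (drop (l - 1 + i) as) + 1 = j"
    using ij l assms(1) by auto
  note add = multilinear_map_add[OF assms(2)[OF ij(2)] len] multilinear_map_add[OF assms(3)[OF ij(2)] len]
  show "scale (of_int (minus_one_pow (int (l * (i + 1) + i * j) + int i * sum_list (take (l - 1) d))))
      (\<mu> j (take (l - 1) as @ [\<mu> i (take i (drop (l - 1) as)) + \<mu>' i (take i (drop (l - 1) as))] @ drop (l - 1 + i) as) +
       \<mu>' j (take (l - 1) as @ [\<mu> i (take i (drop (l - 1) as)) + \<mu>' i (take i (drop (l - 1) as))] @ drop (l - 1 + i) as)) =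
    scale (of_int (minus_one_pow (int (l * (i + 1) + i * j) + int i * sum_list (take (l - 1) d))))
      (\<mu> j (take (l - 1) as @ [\<mu> i (take i (drop (l - 1) as))] @ drop (l - 1 + i) as)) +
    scale (of_int (minus_one_pow (int (l * (i + 1) + i * j) + int i * sum_list (take (l - 1) d))))
      (\<mu> j (take (l - 1) as @ [\<mu>' i (take i (drop (l - 1) as))] @ drop (l - 1 + i) as)) +
    (scale (of_int (minus_one_pow (int (l * (i + 1) + i * j) + int i * sum_list (take (l - 1) d))))
      (\<mu>' j (take (l - 1) as @ [\<mu> i (take i (drop (l - 1) as))] @ drop (l - 1 + i) as)) +
    scale (of_int (minus_one_pow (int (l * (i + 1) + i * j) + int i * sum_list (take (l - 1) d))))
      (\<mu>' j (take (l - 1) as @ [\<mu>' i (take i (drop (l - 1) as))] @ drop (l - 1 + i) as)))"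
    using add by (simp add: scale_right_distrib)
qed

lemma homogeneous_map_nth:
  assumes "homogeneous A d xs" "w \<in> permutations_of_set {..<length xs}"
  shows "homogeneous A (map ((!) d) w) (map ((!) xs) w)" "length (map ((!) xs) w) = length xs"
proof -
  have w: "set w = {..<length xs}" "length w = length xs"
    using permutations_of_setD(1)[OF assms(2)] length_finite_permutations_of_set[OF assms(2)]
    by simp_all
  show "homogeneous A (map ((!) d) w) (map ((!) xs) w)"
    unfolding homogeneous_def list_all2_conv_all_nth
  proof (intro conjI allI impI)
    fix q assume "q < length (map ((!) d) w)"
    then have "q < length w" "w ! q < length xs" using nth_mem[of q w] w(1) by auto
    then show "map ((!) xs) w ! q \<in> A (map ((!) d) w ! q)"
      using assms(1) by (auto simp: homogeneous_def list_all2_conv_all_nth)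
  qed simp
  show "length (map ((!) xs) w) = length xs" using w(2) by simp
qed

end

section \<open>Conclusion for single and compatible structures\<close>

lemma A_infinity_algebraD:
  assumes "A_infinity_algebra scale A \<mu>"
  shows "graded_vector_space scale A"
    and "1 \<le> k \<Longrightarrow> multilinear_map scale k (\<mu> k)"
    and "1 \<le> k \<Longrightarrow> has_degree A k (2 - int k) (\<mu> k)"
    and "1 \<le> n \<Longrightarrow> length as = n \<Longrightarrow> homogeneous A d as \<Longrightarrow> A_infinity_sum scale \<mu> \<mu> n d as = 0"
  using assms unfolding A_infinity_algebra_def A_infinity_sum_def by blast+

text \<open>Each summand is a sign times the associative identity of \<open>\<mu>\<close> at a
  homogeneous rearrangement of the arguments, hence 0.\<close>

lemma L_infinity_algebra_skew_symmetrization: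
  assumes "A_infinity_algebra scale A \<mu>"
  shows "L_infinity_algebra scale A (skew_symmetrization scale A \<mu>)"
proof -
  note A = A_infinity_algebraD[OF assms]
  interpret graded_vector_space scale A by (rule A(1))
  have "L_infinity_sum scale (skew_symmetrization scale A \<mu>) (skew_symmetrization scale A \<mu>) n d xs = 0"
    if "1 \<le> n" "length xs = n" "homogeneous A d xs" for n d xs
    using that A homogeneous_map_nth[OF that(3)]
    by (subst L_infinity_sum_skew_symmetrization) auto
  then show ?thesis
    unfolding L_infinity_algebra_def
    using A multilinear_map_skew_symmetrization has_degree_skew_symmetrization
      skew_symmetric_skew_symmetrization by blast
qed

theorem proposition4p6:
  fixes scale :: "'k::field_char_0 \<Rightarrow> 'a::ab_group_add \<Rightarrow> 'a"
    and A :: "int \<Rightarrow> 'a set"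
    and \<mu> \<mu>' :: "nat \<Rightarrow> 'a list \<Rightarrow> 'a"
  assumes "compatible_A_infinity_algebra scale A \<mu> \<mu>'"
  shows "compatible_L_infinity_algebra scale A
    (skew_symmetrization scale A \<mu>) (skew_symmetrization scale A \<mu>')"
proof -
  have alg: "A_infinity_algebra scale A \<mu>" "A_infinity_algebra scale A \<mu>'"
      "A_infinity_algebra scale A (\<lambda>k as. \<mu> k as + \<mu>' k as)"
    using assms by (auto simp: compatible_A_infinity_algebra_def)
  note A = A_infinity_algebraD[OF alg(1)] and A' = A_infinity_algebraD[OF alg(2)]
    and AA' = A_infinity_algebraD[OF alg(3)]
  interpret graded_vector_space scale A by (rule A(1))
  have "L_infinity_sum scale (skew_symmetrization scale A \<mu>) (skew_symmetrization scale A \<mu>') n d xs +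
      L_infinity_sum scale (skew_symmetrization scale A \<mu>') (skew_symmetrization scale A \<mu>) n d xs = 0"
    if n: "1 \<le> n" "length xs = n" "homogeneous A d xs" for n d xs
  proof -
    \<comment> \<open>Expanding the identity of the sum structure leaves just these two mixed terms,
      because the diagonal ones vanish by the identities of \<open>\<mu>\<close> and
      \<open>\<mu>'\<close>.\<close>
    have "A_infinity_sum scale \<mu> \<mu>' n (map ((!) d) w) (map ((!) xs) w) +
        A_infinity_sum scale \<mu>' \<mu> n (map ((!) d) w) (map ((!) xs) w) = 0"
      if "w \<in> permutations_of_set {..<n}" for w
    proof -
      note w = homogeneous_map_nth[OF n(3), of w, unfolded n(2), OF that]
      show ?thesis
        using A_infinity_sum_add[OF w(2) A(2) A'(2), of "map ((!) d) w"]
          A(4)[OF n(1) w(2,1)] A'(4)[OF n(1) w(2,1)] AA'(4)[OF n(1) w(2,1)]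
        by simp
    qed
    then have "(\<Sum>w\<in>permutations_of_set {..<n}. scale (of_int (inversion_prod (skew_sign ((!) d)) w))
        (A_infinity_sum scale \<mu> \<mu>' n (map ((!) d) w) (map ((!) xs) w) +
          A_infinity_sum scale \<mu>' \<mu> n (map ((!) d) w) (map ((!) xs) w))) = 0"
      by (intro sum.neutral) simp
    moreover have "L_infinity_sum scale (skew_symmetrization scale A \<mu>) (skew_symmetrization scale A \<mu>') n d xs =
        - (\<Sum>w\<in>permutations_of_set {..<n}. scale (of_int (inversion_prod (skew_sign ((!) d)) w))
            (A_infinity_sum scale \<mu> \<mu>' n (map ((!) d) w) (map ((!) xs) w)))"
      by (rule L_infinity_sum_skew_symmetrization) (use n A(2) A'(2,3) in auto)
    moreover have "L_infinity_sum scale (skew_symmetrization scale A \<mu>') (skew_symmetrization scale A \<mu>) n d xs =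
        - (\<Sum>w\<in>permutations_of_set {..<n}. scale (of_int (inversion_prod (skew_sign ((!) d)) w))
            (A_infinity_sum scale \<mu>' \<mu> n (map ((!) d) w) (map ((!) xs) w)))"
      by (rule L_infinity_sum_skew_symmetrization) (use n A(2,3) A'(2) in auto)
    ultimately show ?thesis
      by (simp add: scale_right_distrib sum.distrib add_eq_0_iff)
  qed
  then show ?thesis
    unfolding compatible_L_infinity_algebra_def
    using L_infinity_algebra_skew_symmetrization[OF alg(1)] L_infinity_algebra_skew_symmetrization[OF alg(2)]
    by blast
qed

end
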